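(* For any finite root system $(G,\beta,R)$, the Lie algebra $L(R)$ is a semisimple Lie algebra and the standard $G$-grading on it is quasi-good. This grading is good if and only if $\widehat G$ is a maximal quasitorus in $\mathrm{Aut}(L(R))$, i.e., the centralizer of $\widehat G$ in $\mathrm{Aut}(L(R))$ equals $\widehat G$.
   Context: All algebras are finite-dimensional over $\mathbb{C}$. An alternating bicharacter on a finite abelian group $G$ is a map $\beta:G\times G\to\mathbb{C}^\times$ multiplicative in each variable with $\beta(a,a)=1$; $\mathrm{Rad}(\beta)=\{a:\beta(a,b)=1\ \forall b\in G\}$. Assume $\beta$ nontrivial, i.e. $\mathrm{Rad}(\beta)\ne G$. A subset $R\subset G$ is a finite root system in $(G,\beta)$ if: (FRS0) $R\subset G\setminus\mathrm{Rad}(\beta)$ and $R$ generates $G$; (FRS1) $a\in R\Rightarrow -a\in R$; (FRS2) $a,b\in R$ and $\beta(a,b)\ne1$ imply $a+b\in R$. Choose a bimultiplicative map $\xi:G\times G\to\mathbb{C}^\times$ with $\xi(a,b)\xi(b,a)^{-1}=\beta(a,b)$ for all $a,b\in G$. Then $L(R)=\bigoplus_{a\in R}\mathbb{C}u_a$ is the Lie algebra with bracket $[u_a,u_b]=(\xi(a,b)-\xi(b,a))u_{a+b}$ (zero when $\beta(a,b)=1$); up to graded isomorphism it does not depend on $\xi$. The decomposition $L(R)=\bigoplus_{a\in R}\mathbb{C}u_a$ is the standard $G$-grading. The dual group $\widehat G=\mathrm{Hom}(G,\mathbb{C}^\times)$ embeds in $\mathrm{Aut}(L(R))$ by $\sigma\cdot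 u_a=\sigma(a)u_a$. A quasitorus is an abelian algebraic group consisting of semisimple elements. A grading is quasi-good if $0$ is not in its support and each homogeneous component (of degree in the support) is 1-dimensional. A grading on a semisimple Lie algebra $L$ is good if it is quasi-good and is the grading induced by the action on $L$ of a finite maximal quasitorus $T$ of $\mathrm{Aut}(L)$ (so it is a grading by $\widehat T$, the character group of $T$). *)

theory Defs
  imports "HOL-Analysis.Cartesian_Space" "HOL-Algebra.Generated_Groups" "HOL-Algebra.Bij"
begin

section \<open>Lie algebras\<close>

text \<open>
  A (finite-dimensional) complex Lie algebra is a subspace \<open>L\<close> of some \<open>\<complex>\<^sup>n\<close> together with a
  bracket. Only the values of the bracket on \<open>L\<close> matter.
\<close>

definition lie_algebra ::
  "(complex^'n) set \<Rightarrow> (complex^'n \<Rightarrow> complex^'n \<Rightarrow> complex^'n) \<Rightarrow> bool" where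
  "lie_algebra L br \<longleftrightarrow>
     vec.subspace L \<and>
     (\<forall>x\<in>L. \<forall>y\<in>L. br x y \<in> L) \<and>
     (\<forall>x\<in>L. \<forall>y\<in>L. \<forall>z\<in>L. br (x + y) z = br x z + br y z \<and> br x (y + z) = br x y + br x z) \<and>
     (\<forall>c. \<forall>x\<in>L. \<forall>y\<in>L. br (c *s x) y = c *s br x y \<and> br x (c *s y) = c *s br x y) \<and>
     (\<forall>x\<in>L. br x x = 0) \<and>
     (\<forall>x\<in>L. \<forall>y\<in>L. \<forall>z\<in>L. br x (br y z) + br y (br z x) + br z (br x y) = 0)"

definition lie_ideal ::
  "(complex^'n) set \<Rightarrow> (complex^'n \<Rightarrow> complex^'n \<Rightarrow> complex^'n) \<Rightarrow> (complex^'n) set \<Rightarrow> bool" where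
  "lie_ideal L br I \<longleftrightarrow> vec.subspace I \<and> I \<subseteq> L \<and> (\<forall>x\<in>L. \<forall>y\<in>I. br x y \<in> I)"

primrec derived_series ::
  "(complex^'n \<Rightarrow> complex^'n \<Rightarrow> complex^'n) \<Rightarrow> (complex^'n) set \<Rightarrow> nat \<Rightarrow> (complex^'n) set" where
  "derived_series br I 0 = I"
| "derived_series br I (Suc k) =
     vec.span {br x y | x y. x \<in> derived_series br I k \<and> y \<in> derived_series br I k}"

definition lie_solvable ::
  "(complex^'n \<Rightarrow> complex^'n \<Rightarrow> complex^'n) \<Rightarrow> (complex^'n) set \<Rightarrow> bool" where
  "lie_solvable br I \<longleftrightarrow> (\<exists>k. derived_series br I k = {0})"

text \<open>The radical, i.e. the largest solvable ideal, is zero.\<close>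

definition semisimple_lie_algebra ::
  "(complex^'n) set \<Rightarrow> (complex^'n \<Rightarrow> complex^'n \<Rightarrow> complex^'n) \<Rightarrow> bool" where
  "semisimple_lie_algebra L br \<longleftrightarrow>
     lie_algebra L br \<and> (\<forall>I. lie_ideal L br I \<and> lie_solvable br I \<longrightarrow> I = {0})"


section \<open>The automorphism group and its quasitori\<close>

text \<open>Automorphisms are extensional functions on \<open>L\<close>, composed as in \<^const>\<open>BijGroup\<close>.\<close>

definition lie_aut ::
  "(complex^'n) set \<Rightarrow> (complex^'n \<Rightarrow> complex^'n \<Rightarrow> complex^'n) \<Rightarrow> (complex^'n \<Rightarrow> complex^'n) monoid"
  where
  "lie_aut L br = (BijGroup L)\<lparr>carrier := {f \<in> Bij L.
     (\<forall>x\<in>L. \<forall>y\<in>L. f (x + y) = f x + f y) \<and>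
     (\<forall>c. \<forall>x\<in>L. f (c *s x) = c *s f x) \<and>
     (\<forall>x\<in>L. \<forall>y\<in>L. f (br x y) = br (f x) (f y))}\<rparr>"

definition centralizer :: "('a, 'b) monoid_scheme \<Rightarrow> 'a set \<Rightarrow> 'a set" where
  "centralizer A S = {g \<in> carrier A. \<forall>s\<in>S. g \<otimes>\<^bsub>A\<^esub> s = s \<otimes>\<^bsub>A\<^esub> g}"

text \<open>
  Polynomial functions on \<open>End(L)\<close>: the maps \<open>f \<mapsto> (f x) $ i\<close> with \<open>x \<in> L\<close> span the linear
  functionals on \<open>End(L)\<close>, hence generate its coordinate ring. Since \<open>GL(L)\<close> is a principal open
  subset of \<open>End(L)\<close> and \<open>Aut(L)\<close> is closed in \<open>GL(L)\<close>, the closed subsets of \<open>Aut(L)\<close>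
  are the zero loci in \<open>Aut(L)\<close> of sets of such functions.
\<close>

inductive_set poly_functions ::
  "(complex^'n) set \<Rightarrow> ((complex^'n \<Rightarrow> complex^'n) \<Rightarrow> complex) set" for L where
  const: "(\<lambda>f. c) \<in> poly_functions L"
| coeff: "x \<in> L \<Longrightarrow> (\<lambda>f. f x $ i) \<in> poly_functions L"
| add: "p \<in> poly_functions L \<Longrightarrow> q \<in> poly_functions L \<Longrightarrow> (\<lambda>f. p f + q f) \<in> poly_functions L"
| mult: "p \<in> poly_functions L \<Longrightarrow> q \<in> poly_functions L \<Longrightarrow> (\<lambda>f. p f * q f) \<in> poly_functions L"

definition zariski_closed_in_aut ::
  "(complex^'n) set \<Rightarrow> (complex^'n \<Rightarrow> complex^'n \<Rightarrow> complex^'n) \<Rightarrow> (complex^'n \<Rightarrow> complex^'n) set \<Rightarrow> bool"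
  where
  "zariski_closed_in_aut L br T \<longleftrightarrow>
     (\<exists>P \<subseteq> poly_functions L. T = {f \<in> carrier (lie_aut L br). \<forall>p\<in>P. p f = 0})"

text \<open>Over \<open>\<complex>\<close>, semisimple means diagonalizable.\<close>

definition semisimple_endo :: "(complex^'n) set \<Rightarrow> (complex^'n \<Rightarrow> complex^'n) \<Rightarrow> bool" where
  "semisimple_endo L f \<longleftrightarrow> vec.span {v \<in> L. \<exists>c. f v = c *s v} = L"

definition quasitorus ::
  "(complex^'n) set \<Rightarrow> (complex^'n \<Rightarrow> complex^'n \<Rightarrow> complex^'n) \<Rightarrow> (complex^'n \<Rightarrow> complex^'n) set \<Rightarrow> bool"
  where
  "quasitorus L br T \<longleftrightarrow>
     subgroup T (lie_aut L br) \<and>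
     zariski_closed_in_aut L br T \<and>
     (\<forall>s\<in>T. \<forall>t\<in>T. s \<otimes>\<^bsub>lie_aut L br\<^esub> t = t \<otimes>\<^bsub>lie_aut L br\<^esub> s) \<and>
     (\<forall>t\<in>T. semisimple_endo L t)"

definition maximal_quasitorus ::
  "(complex^'n) set \<Rightarrow> (complex^'n \<Rightarrow> complex^'n \<Rightarrow> complex^'n) \<Rightarrow> (complex^'n \<Rightarrow> complex^'n) set \<Rightarrow> bool"
  where
  "maximal_quasitorus L br T \<longleftrightarrow>
     quasitorus L br T \<and> (\<forall>T'. quasitorus L br T' \<and> T \<subseteq> T' \<longrightarrow> T' = T)"


section \<open>Characters\<close>

definition additive_group :: "'g::ab_group_add monoid" where
  "additive_group = \<lparr>carrier = UNIV, monoid.mult = (+), one = 0\<rparr>"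

definition complex_units :: "complex monoid" where
  "complex_units = \<lparr>carrier = - {0}, monoid.mult = (*), one = 1\<rparr>"

definition character_group :: "('a, 'b) monoid_scheme \<Rightarrow> ('a \<Rightarrow> complex) monoid" where
  "character_group A =
     \<lparr>carrier = hom A complex_units \<inter> extensional (carrier A),
      monoid.mult = (\<lambda>\<rho> \<psi>. \<lambda>a\<in>carrier A. \<rho> a * \<psi> a),
      one = (\<lambda>a\<in>carrier A. 1)\<rparr>"


section \<open>Gradings\<close>

definition lie_grading ::
  "(complex^'n) set \<Rightarrow> (complex^'n \<Rightarrow> complex^'n \<Rightarrow> complex^'n) \<Rightarrow>
   ('g::ab_group_add \<Rightarrow> (complex^'n) set) \<Rightarrow> bool" where
  "lie_grading L br \<Gamma> \<longleftrightarrow>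
     (\<forall>a. vec.subspace (\<Gamma> a) \<and> \<Gamma> a \<subseteq> L) \<and>
     (\<forall>x\<in>L. \<exists>!f. (\<forall>a. f a \<in> \<Gamma> a) \<and> finite {a. f a \<noteq> 0} \<and> x = (\<Sum>a | f a \<noteq> 0. f a)) \<and>
     (\<forall>a b. \<forall>x\<in>\<Gamma> a. \<forall>y\<in>\<Gamma> b. br x y \<in> \<Gamma> (a + b))"

definition grading_support :: "('g \<Rightarrow> (complex^'n) set) \<Rightarrow> 'g set" where
  "grading_support \<Gamma> = {a. \<Gamma> a \<noteq> {0}}"

definition quasi_good_grading ::
  "(complex^'n) set \<Rightarrow> (complex^'n \<Rightarrow> complex^'n \<Rightarrow> complex^'n) \<Rightarrow>
   ('g::ab_group_add \<Rightarrow> (complex^'n) set) \<Rightarrow> bool" where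
  "quasi_good_grading L br \<Gamma> \<longleftrightarrow>
     lie_grading L br \<Gamma> \<and> 0 \<notin> grading_support \<Gamma> \<and>
     (\<forall>a\<in>grading_support \<Gamma>. vec.dim (\<Gamma> a) = 1)"

definition eigencomponent ::
  "(complex^'n) set \<Rightarrow> (complex^'n \<Rightarrow> complex^'n) set \<Rightarrow> ((complex^'n \<Rightarrow> complex^'n) \<Rightarrow> complex) \<Rightarrow>
   (complex^'n) set" where
  "eigencomponent L T \<rho> = {x \<in> L. \<forall>t\<in>T. t x = \<rho> t *s x}"

text \<open>
  A grading by a group \<open>G\<close> is the grading induced by \<open>T\<close> if the degrees correspond under a group
  isomorphism from \<open>G\<close> to the character group of \<open>T\<close>. It is essential that the grading groups are
  identified, not merely the decompositions of \<open>L\<close> into homogeneous components: the same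
  decomposition may be a grading by different groups generated by the support.
\<close>

definition good_grading ::
  "(complex^'n) set \<Rightarrow> (complex^'n \<Rightarrow> complex^'n \<Rightarrow> complex^'n) \<Rightarrow>
   ('g::ab_group_add \<Rightarrow> (complex^'n) set) \<Rightarrow> bool" where
  "good_grading L br \<Gamma> \<longleftrightarrow>
     semisimple_lie_algebra L br \<and> quasi_good_grading L br \<Gamma> \<and>
     (\<exists>T. maximal_quasitorus L br T \<and> finite T \<and>
        (\<exists>\<phi> \<in> iso additive_group (character_group ((lie_aut L br)\<lparr>carrier := T\<rparr>)).
           \<forall>a. \<Gamma> a = eigencomponent L T (\<phi> a)))"


section \<open>Finite root systems and their Lie algebras\<close>

definition bimultiplicative :: "('g::ab_group_add \<Rightarrow> 'g \<Rightarrow> complex) \<Rightarrow> bool" where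
  "bimultiplicative f \<longleftrightarrow>
     (\<forall>a b. f a b \<noteq> 0) \<and>
     (\<forall>a b c. f (a + b) c = f a c * f b c \<and> f a (b + c) = f a b * f a c)"

definition alternating_bicharacter :: "('g::ab_group_add \<Rightarrow> 'g \<Rightarrow> complex) \<Rightarrow> bool" where
  "alternating_bicharacter \<beta> \<longleftrightarrow> bimultiplicative \<beta> \<and> (\<forall>a. \<beta> a a = 1)"

definition Rad :: "('g \<Rightarrow> 'g \<Rightarrow> complex) \<Rightarrow> 'g set" where
  "Rad \<beta> = {a. \<forall>b. \<beta> a b = 1}"

definition finite_root_system :: "('g::ab_group_add \<Rightarrow> 'g \<Rightarrow> complex) \<Rightarrow> 'g set \<Rightarrow> bool" where
  "finite_root_system \<beta> R \<longleftrightarrow>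
     R \<subseteq> UNIV - Rad \<beta> \<and> generate additive_group R = UNIV \<and>
     (\<forall>a\<in>R. - a \<in> R) \<and>
     (\<forall>a\<in>R. \<forall>b\<in>R. \<beta> a b \<noteq> 1 \<longrightarrow> a + b \<in> R)"

text \<open>The basis vector \<open>u\<^sub>a\<close> is \<open>axis a 1\<close>.\<close>

definition root_space :: "('g::finite) set \<Rightarrow> (complex^'g) set" where
  "root_space R = vec.span ((\<lambda>a. axis a 1) ` R)"

text \<open>
  The bilinear map with \<open>[u\<^sub>a, u\<^sub>b] = (\<xi>(a,b) - \<xi>(b,a)) u\<^bsub>a+b\<^esub>\<close> for \<open>a, b \<in> R\<close>. The coefficient
  vanishes when \<open>\<beta>(a,b) = 1\<close>, where \<open>a + b\<close> need not lie in \<open>R\<close>.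
\<close>

definition root_bracket ::
  "('g::{finite,ab_group_add} \<Rightarrow> 'g \<Rightarrow> complex) \<Rightarrow> 'g set \<Rightarrow>
   (complex, 'g) vec \<Rightarrow> (complex, 'g) vec \<Rightarrow> (complex, 'g) vec"
  where
  "root_bracket \<xi> R x y =
     (\<Sum>a\<in>R. \<Sum>b\<in>R. (x $ a * y $ b * (\<xi> a b - \<xi> b a)) *s axis (a + b) 1)"

definition standard_grading :: "('g::finite) set \<Rightarrow> 'g \<Rightarrow> (complex^'g) set" where
  "standard_grading R a = (if a \<in> R then vec.span {axis a 1} else {0})"

text \<open>The automorphism \<open>u\<^sub>a \<mapsto> \<sigma>(a) u\<^sub>a\<close>, and the image of the dual group in \<open>Aut(L(R))\<close>.\<close>

definition dual_action :: "('g::finite) set \<Rightarrow> ('g \<Rightarrow> complex) \<Rightarrow> complex^'g \<Rightarrow> complex^'g" where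
  "dual_action R \<sigma> = (\<lambda>x\<in>root_space R. \<chi> a. \<sigma> a * x $ a)"

definition dual_image :: "('g::{finite,ab_group_add}) set \<Rightarrow> ((complex, 'g) vec \<Rightarrow> (complex, 'g) vec) set" where
  "dual_image R = dual_action R ` carrier (character_group additive_group)"

end

theory Submission
  imports Defs "HOL-Algebra.Multiplicative_Group" "HOL-Analysis.Complex_Transcendental"
begin

text \<open>
  Let \<open>D\<close> be the image of the dual group. Characters separate the points of \<open>G\<close>, so an
  automorphism commuting with \<open>D\<close> is diagonal in the basis \<open>u\<^sub>a\<close>; conversely diagonal
  automorphisms commute with \<open>D\<close>. Hence the centralizer \<open>C\<close> of \<open>D\<close> is itself a quasitorus,
  and it contains every quasitorus containing \<open>D\<close>: maximality of \<open>D\<close> means \<open>C = D\<close>. If the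
  grading is good by means of \<open>T\<close>, then \<open>T \<subseteq> D \<subseteq> C\<close> and maximality of \<open>T\<close> forces equality; the
  other direction is Pontryagin duality for \<open>G\<close>.

  For semisimplicity, values of \<open>\<xi>\<close> are roots of unity, and then the adjoint of \<open>ad u\<^sub>a\<close> for the
  standard hermitian form is \<open>\<xi>(a,a) ad u\<^bsub>-a\<^esub>\<close>.
  Since \<open>ad L\<close> is closed under adjoints, abelian ideals are central, and the center is zero
  because no root lies in the radical of \<open>\<beta>\<close>.
\<close>

section \<open>Characters of a finite abelian group\<close>

lemma group_additive_group: "group (additive_group :: 'g::ab_group_add monoid)"
proof (rule groupI)
  fix x :: 'g
  show "\<exists>y\<in>carrier additive_group. y \<otimes>\<^bsub>additive_group\<^esub> x = \<one>\<^bsub>additive_group\<^esub>"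
    by (rule bexI[of _ "- x"]) (auto simp: additive_group_def)
qed (auto simp: additive_group_def add.assoc)

text \<open>Here \<open>p n\<close> is the multiple n b; later proofs use only its recursion and its
  return to 0. The return after \<open>CARD('g)\<close> steps is Lagrange's theorem.\<close>

lemma exists_periodic_multiples:
  fixes b :: "'g::{finite,ab_group_add}"
  obtains p :: "nat \<Rightarrow> 'g" where "p 0 = 0" "\<And>n. p (Suc n) = p n + b" "p CARD('g) = 0"
proof
  interpret group "additive_group :: 'g monoid"
    by (rule group_additive_group)
  show "b [^]\<^bsub>additive_group\<^esub> (0::nat) = 0"
    by (simp add: additive_group_def)
  show "b [^]\<^bsub>additive_group\<^esub> (Suc n) = b [^]\<^bsub>additive_group\<^esub> n + b" for n
    by (simp add: additive_group_def)
  have "b [^]\<^bsub>additive_group\<^esub> order (additive_group :: 'g monoid) = \<one>\<^bsub>additive_group\<^esub>"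
    by (rule pow_order_eq_1) (simp add: additive_group_def)
  then show "b [^]\<^bsub>additive_group\<^esub> CARD('g) = 0"
    by (simp add: additive_group_def order_def)
qed

abbreviation chars :: "('g::ab_group_add \<Rightarrow> complex) set" where
  "chars \<equiv> carrier (character_group additive_group)"

lemma mem_chars_iff: "\<sigma> \<in> chars \<longleftrightarrow> (\<forall>a. \<sigma> a \<noteq> 0) \<and> (\<forall>a b. \<sigma> (a + b) = \<sigma> a * \<sigma> b)"
  by (auto simp: character_group_def hom_def additive_group_def complex_units_def)

lemma charD:
  assumes "\<sigma> \<in> chars"
  shows "\<sigma> a \<noteq> 0" "\<sigma> (a + b) = \<sigma> a * \<sigma> b" "\<sigma> 0 = 1" "\<sigma> (- a) = inverse (\<sigma> a)"
proof -
  show nz: "\<sigma> a \<noteq> 0" and add: "\<sigma> (a + b) = \<sigma> a * \<sigma> b" for a b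
    using assms by (auto simp: mem_chars_iff)
  show one: "\<sigma> 0 = 1"
    using add[of 0 0] nz[of 0] by simp
  show "\<sigma> (- a) = inverse (\<sigma> a)"
    using add[of a "- a"] one nz[of a] by (simp add: field_simps)
qed

lemma char_power_card:
  fixes \<sigma> :: "'g::{finite,ab_group_add} \<Rightarrow> complex"
  assumes "\<sigma> \<in> chars"
  shows "\<sigma> a ^ CARD('g) = 1"
proof -
  obtain p where p: "p 0 = 0" "\<And>n. p (Suc n) = p n + a" "p CARD('g) = 0"
    by (rule exists_periodic_multiples[of a]) blast
  have "\<sigma> (p n) = \<sigma> a ^ n" for n
    by (induction n) (simp_all add: p charD[OF assms])
  from this[of "CARD('g)"] show ?thesis
    by (simp add: p charD[OF assms])
qed

lemma norm_char:
  fixes \<sigma> :: "'g::{finite,ab_group_add} \<Rightarrow> complex"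
  assumes "\<sigma> \<in> chars"
  shows "norm (\<sigma> a) = 1"
  using power_eq_1_iff[OF char_power_card[OF assms]] by auto

lemma finite_chars: "finite (chars :: ('g::{finite,ab_group_add} \<Rightarrow> complex) set)"
proof (rule finite_subset)
  show "chars \<subseteq> (UNIV :: 'g set) \<rightarrow>\<^sub>E {z. z ^ CARD('g) = 1}"
    by (auto simp: PiE_def char_power_card)
  show "finite ((UNIV :: 'g set) \<rightarrow>\<^sub>E {z::complex. z ^ CARD('g) = 1})"
    by (intro finite_PiE) (auto intro!: finite_roots_unity)
qed

text \<open>Translating the summation variable by \<open>b\<close> multiplies the sum by
  \<open>\<sigma> b\<close>, which differs from 1.\<close>

lemma char_sum_eq_0:
  fixes \<sigma> :: "'g::{finite,ab_group_add} \<Rightarrow> complex"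
  assumes "\<sigma> \<in> chars" "\<sigma> b \<noteq> 1"
  shows "(\<Sum>a\<in>UNIV. \<sigma> a) = 0"
proof -
  have "(\<Sum>a\<in>UNIV. \<sigma> a) = (\<Sum>a\<in>UNIV. \<sigma> (b + a))"
    by (rule sum.reindex_bij_witness[of _ "\<lambda>a. b + a" "\<lambda>a. a - b"]) auto
  also have "\<dots> = \<sigma> b * (\<Sum>a\<in>UNIV. \<sigma> a)"
    by (simp add: charD[OF assms(1)] sum_distrib_left)
  finally show ?thesis
    using assms(2) by simp
qed

text \<open>
  Discrete Fourier transform along \<open>b\<close>: \<open>f\<close> is the average of its projections onto the
  eigenspaces of the shift by \<open>b\<close>.
\<close>

lemma shift_eigenfunction:
  fixes f :: "'g::{finite,ab_group_add} \<Rightarrow> complex"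
  assumes add: "\<And>f g. W f \<Longrightarrow> W g \<Longrightarrow> W (\<lambda>x. f x + g x)"
    and scale: "\<And>c f. W f \<Longrightarrow> W (\<lambda>x. c * f x)"
    and shift: "\<And>d f. W f \<Longrightarrow> W (\<lambda>x. f (x + d))"
    and f: "W f" "f x0 \<noteq> 0"
  obtains h \<nu> x1 where "W h" "h x1 \<noteq> 0" "\<And>x. h (x + b) = \<nu> * h x"
    "\<And>d \<mu>. \<forall>x. f (x + d) = \<mu> * f x \<Longrightarrow> \<forall>x. h (x + d) = \<mu> * h x"
proof -
  define N where "N = CARD('g)"
  have N: "N \<ge> 1"
    by (simp add: N_def Suc_le_eq)
  obtain p where p: "p 0 = 0" "\<And>n. p (Suc n) = p n + b" "p N = 0"
    unfolding N_def by (rule exists_periodic_multiples[of b]) blast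
  \<comment> \<open>The \<open>w j\<close> are the N-th roots of unity. For such \<open>l\<close>,
    \<open>P l\<close> is N times the projection of \<open>f\<close> onto the eigenfunctions of the
    shift by \<open>b\<close> with eigenvalue \<open>inverse l\<close>.\<close>
  define w where "w j = exp (2 * of_real pi * \<i> * of_nat j / of_nat N)" for j
  define P where "P l x = (\<Sum>k<N. l ^ k * f (x + p k))" for l x
  have w_pow: "w j ^ k = w k ^ j" for j k
    by (simp add: w_def flip: exp_of_nat_mult) (simp add: mult_ac)
  have w_eq_1: "w k = 1 \<longleftrightarrow> N dvd k" for k
    using complex_root_unity_eq_1[OF N, of k] by (simp add: w_def)
  have "w j ^ N = 1" for j
    by (simp add: w_pow w_eq_1[THEN iffD2])
  have w_sum: "(\<Sum>j<N. w j ^ k) = (if k = 0 then of_nat N else 0)" if "k < N" for k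
  proof (cases "k = 0")
    case False
    then have "w k \<noteq> 1"
      using that by (auto simp: w_eq_1 dest: dvd_imp_le)
    moreover have "(\<Sum>j<N. w k ^ j) * (w k - 1) = w k ^ N - 1"
      using power_diff_1_eq[of "w k" N] by (simp add: mult.commute)
    ultimately show ?thesis
      using False \<open>w k ^ N = 1\<close> by (simp add: w_pow[of _ k])
  qed simp
  \<comment> \<open>Summing over all roots of unity keeps only the term \<open>k = 0\<close>, so the
    projections at \<open>x0\<close> add up to N times \<open>f x0\<close>, and one of them is
    nonzero.\<close>
  have "(\<Sum>j<N. P (w j) x0) = (\<Sum>k<N. (\<Sum>j<N. w j ^ k) * f (x0 + p k))"
    unfolding P_def by (subst sum.swap) (simp add: sum_distrib_right)
  also have "\<dots> = (\<Sum>k<N. if k = 0 then of_nat N * f x0 else 0)"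
    by (intro sum.cong) (auto simp: w_sum p)
  also have "\<dots> = of_nat N * f x0"
    using N by simp
  finally have "(\<Sum>j<N. P (w j) x0) \<noteq> 0"
    using f N by simp
  then obtain j where j: "P (w j) x0 \<noteq> 0"
    by (meson sum.neutral)
  let ?l = "w j"
  show thesis
  proof (rule that[of "P ?l"])
    have "W (\<lambda>x. \<Sum>k<n. ?l ^ k * f (x + p k))" for n
    proof (induction n)
      case 0
      show ?case
        using scale[OF f(1), of 0] by simp
    next
      case (Suc n)
      then show ?case
        using add[OF Suc scale[OF shift[OF f(1)]]] by simp
    qed
    then show "W (P ?l)"
      by (simp add: P_def[abs_def])
    show "P ?l x0 \<noteq> 0"
      by (fact j)
    show "P ?l (x + b) = inverse ?l * P ?l x" for x
    proof -
      define g where "g k = ?l ^ k * f (x + p k)" for k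
      \<comment> \<open>Moving the index by one turns the sum for \<open>x\<close> into
        \<open>?l\<close> times the sum for \<open>x + b\<close>. The two boundary terms agree
        because both \<open>?l ^ k\<close> and \<open>p k\<close> return to their start at
        \<open>k = N\<close>.\<close>
      have "g 0 + (\<Sum>k<N. g (Suc k)) = (\<Sum>k<N. g k) + g N"
        by (simp flip: sum.lessThan_Suc_shift)
      moreover have "g N = g 0"
        using \<open>?l ^ N = 1\<close> by (simp add: g_def p)
      moreover have "(\<Sum>k<N. g (Suc k)) = ?l * P ?l (x + b)"
        by (simp add: g_def P_def p sum_distrib_left mult_ac add_ac)
      ultimately have "?l * P ?l (x + b) = P ?l x"
        by (simp add: g_def P_def)
      moreover have "?l \<noteq> 0"
        by (simp add: w_def)
      ultimately show ?thesis
        by (simp add: field_simps)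
    qed
    \<comment> \<open>Translations commute, so the projection respects eigenvalue equations for
      other shifts. This allows the shifts to be treated one after another.\<close>
    show "\<forall>x. P ?l (x + d) = \<mu> * P ?l x" if "\<forall>x. f (x + d) = \<mu> * f x" for d \<mu>
    proof
      fix x
      have "f (x + d + p k) = \<mu> * f (x + p k)" for k
        using that[rule_format, of "x + p k"] by (simp add: add_ac)
      then show "P ?l (x + d) = \<mu> * P ?l x"
        by (simp add: P_def sum_distrib_left mult_ac)
    qed
  qed
qed

text \<open>Simultaneous diagonalization of the commuting translations on a nonzero invariant
  subspace \<open>W\<close>, by induction over finite sets of shifts. The eigenvalue function
  \<open>\<nu>\<close> of the result is a character, which is how characters are produced
  below.\<close>

lemma common_shift_eigenfunction:
  fixes f :: "'g::{finite,ab_group_add} \<Rightarrow> complex"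
  assumes add: "\<And>f g. W f \<Longrightarrow> W g \<Longrightarrow> W (\<lambda>x. f x + g x)"
    and scale: "\<And>c f. W f \<Longrightarrow> W (\<lambda>x. c * f x)"
    and shift: "\<And>d f. W f \<Longrightarrow> W (\<lambda>x. f (x + d))"
    and f: "W f" "f x0 \<noteq> 0"
  obtains h \<nu> x1 where "W h" "h x1 \<noteq> 0" "\<And>x b. h (x + b) = \<nu> b * h x"
proof -
  have "\<exists>h x1. W h \<and> h x1 \<noteq> 0 \<and> (\<forall>b\<in>B. \<exists>l. \<forall>x. h (x + b) = l * h x)"
    if "finite B" for B :: "'g set"
    using that
  proof induction
    case empty
    show ?case
      using f by auto
  next
    case (insert b B)
    then obtain h x1 where h: "W h" "h x1 \<noteq> 0" "\<forall>b\<in>B. \<exists>l. \<forall>x. h (x + b) = l * h x"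
      by blast
    obtain h' l x2 where h': "W h'" "h' x2 \<noteq> 0" "\<And>x. h' (x + b) = l * h' x"
      "\<And>d \<mu>. \<forall>x. h (x + d) = \<mu> * h x \<Longrightarrow> \<forall>x. h' (x + d) = \<mu> * h' x"
      by (rule shift_eigenfunction[where W = W and f = h and b = b, OF add scale shift h(1,2)]) blast+
    have "\<forall>b'\<in>insert b B. \<exists>l. \<forall>x. h' (x + b') = l * h' x"
      using h(3) h'(3,4) by (metis insertE)
    then show ?case
      using h'(1,2) by blast
  qed
  from this[of UNIV] show thesis
    using that by (metis UNIV_I finite)
qed

text \<open>The translations have a common eigenfunction in a suitable space \<open>W\<close>, and
  its eigenvalues form a character. If that character were 1 at \<open>a\<close>, the eigenfunction
  would be invariant under \<open>a\<close>, which the choice of \<open>W\<close> rules out.\<close>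

lemma chars_separate_points:
  fixes a :: "'g::{finite,ab_group_add}"
  assumes "a \<noteq> 0"
  obtains \<sigma> where "\<sigma> \<in> chars" "\<sigma> a \<noteq> 1"
proof -
  obtain p where p: "p 0 = 0" "\<And>n. p (Suc n) = p n + a" "p CARD('g) = 0"
    by (rule exists_periodic_multiples[of a]) blast
  \<comment> \<open>\<open>W\<close> contains no nonzero function that is invariant under the shift by \<open>a\<close>.\<close>
  define W where "W f \<longleftrightarrow> (\<forall>x. (\<Sum>k<CARD('g). f (x + p k)) = (0::complex))" for f
  have add: "W (\<lambda>x. f x + g x)" if "W f" "W g" for f g
    using that by (simp add: W_def sum.distrib)
  have scale: "W (\<lambda>x. c * f x)" if "W f" for c f
    using that by (simp add: W_def flip: sum_distrib_left)
  have shift: "W (\<lambda>x. f (x + d))" if "W f" for d f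
    unfolding W_def
  proof
    fix x
    show "(\<Sum>k<CARD('g). f (x + p k + d)) = 0"
      using that[unfolded W_def, rule_format, of "x + d"] by (simp add: add_ac)
  qed
  \<comment> \<open>The point mass at 0 minus its translate has telescoping sums along each orbit of
    \<open>a\<close>, so it lies in \<open>W\<close>; it is nonzero because \<open>a\<close>
    is.\<close>
  define e where "e x = (if x = 0 then 1 else 0 :: complex)" for x :: 'g
  have W_e: "W (\<lambda>x. e x - e (x + a))"
    unfolding W_def
  proof
    fix x
    have "(\<Sum>k<CARD('g). e (x + p k) - e (x + p k + a)) =
        (\<Sum>k<CARD('g). e (x + p k) - e (x + p (Suc k)))"
      by (simp add: p add_ac)
    also have "\<dots> = 0"
      by (subst sum_lessThan_telescope') (simp add: p)
    finally show "(\<Sum>k<CARD('g). e (x + p k) - e (x + p k + a)) = 0" .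
  qed
  have e_nz: "e 0 - e (0 + a) \<noteq> 0"
    using assms by (simp add: e_def)
  obtain h \<nu> x1 where h: "W h" "h x1 \<noteq> 0" "\<And>x b. h (x + b) = \<nu> b * h x"
    by (rule common_shift_eigenfunction[where W = W and f = "\<lambda>x. e x - e (x + a)",
          OF add scale shift W_e e_nz]) blast+
  show thesis
  proof
    have "\<nu> (b + c) = \<nu> b * \<nu> c" for b c
    proof -
      have "\<nu> (b + c) * h x1 = h (x1 + b + c)"
        by (simp add: add.assoc flip: h(3))
      also have "\<dots> = \<nu> b * \<nu> c * h x1"
        by (simp add: h(3))
      finally show ?thesis
        using h(2) by simp
    qed
    moreover have "\<nu> b \<noteq> 0" for b
      using h(3)[of "x1 - b" b] h(2) by auto
    ultimately show "\<nu> \<in> chars"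
      by (simp add: mem_chars_iff)
    show "\<nu> a \<noteq> 1"
    proof
      assume "\<nu> a = 1"
      then have "h (x1 + p k) = h x1" for k
        by (induction k) (simp_all add: p h(3) flip: add.assoc)
      then show False
        using h(1)[unfolded W_def, rule_format, of x1] h(2) by simp
    qed
  qed
qed

lemma chars_separate:
  fixes a b :: "'g::{finite,ab_group_add}"
  assumes "\<And>\<sigma>. \<sigma> \<in> chars \<Longrightarrow> \<sigma> a = \<sigma> b"
  shows "a = b"
proof (rule ccontr)
  assume "a \<noteq> b"
  then obtain \<sigma> where \<sigma>: "\<sigma> \<in> chars" "\<sigma> (a - b) \<noteq> 1"
    using chars_separate_points[of "a - b"] by auto
  then show False
    using assms[OF \<sigma>(1)] charD(2)[OF \<sigma>(1), of "a - b" b] charD(1)[OF \<sigma>(1)] by simp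
qed

lemma char_mult_closed: "\<sigma> \<in> chars \<Longrightarrow> \<tau> \<in> chars \<Longrightarrow> (\<lambda>a. \<sigma> a * \<tau> a) \<in> chars"
  by (simp add: mem_chars_iff mult_ac)

lemma char_inverse_closed: "\<sigma> \<in> chars \<Longrightarrow> (\<lambda>a. inverse (\<sigma> a)) \<in> chars"
  by (simp add: mem_chars_iff)

text \<open>Surjectivity in Pontryagin duality, by orthogonality: if \<open>\<psi>\<close> differs
  from every evaluation, it is orthogonal to each of them, and adding these relations over all of G
  contradicts \<open>\<psi>\<close> being nonzero at the trivial character.\<close>

lemma chars_reflexive:
  fixes \<psi> :: "('g::{finite,ab_group_add} \<Rightarrow> complex) \<Rightarrow> complex"
  assumes mult: "\<And>\<sigma> \<tau>. \<sigma> \<in> chars \<Longrightarrow> \<tau> \<in> chars \<Longrightarrow> \<psi> (\<lambda>a. \<sigma> a * \<tau> a) = \<psi> \<sigma> * \<psi> \<tau>"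
    and nz: "\<And>\<sigma>. \<sigma> \<in> chars \<Longrightarrow> \<psi> \<sigma> \<noteq> 0"
  shows "\<exists>a. \<forall>\<sigma>\<in>chars. \<psi> \<sigma> = \<sigma> a"
proof (rule ccontr)
  assume "\<not> ?thesis"
  then have ne: "\<exists>\<sigma>\<in>chars. \<psi> \<sigma> \<noteq> \<sigma> a" for a
    by blast
  have one: "(\<lambda>_. 1) \<in> (chars :: ('g \<Rightarrow> complex) set)"
    by (simp add: mem_chars_iff)
  have "(\<Sum>\<sigma>\<in>chars. \<psi> \<sigma> * inverse (\<sigma> a)) = 0" (is "?S = 0") for a
  proof -
    obtain \<tau> where \<tau>: "\<tau> \<in> chars" "\<psi> \<tau> \<noteq> \<tau> a"
      using ne by blast
    \<comment> \<open>Multiplying the summation variable by \<open>\<tau>\<close> scales the sum by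
      \<open>\<psi> \<tau> / \<tau> a\<close>, a factor different from 1.\<close>
    have "?S = (\<Sum>\<sigma>\<in>chars. \<psi> (\<lambda>b. \<tau> b * \<sigma> b) * inverse (\<tau> a * \<sigma> a))"
      by (rule sum.reindex_bij_witness[of _ "\<lambda>\<sigma> b. \<tau> b * \<sigma> b" "\<lambda>\<sigma> b. inverse (\<tau> b) * \<sigma> b"])
        (use \<tau> in \<open>auto simp: char_mult_closed char_inverse_closed charD simp flip: mult.assoc\<close>)
    also have "\<dots> = \<psi> \<tau> * inverse (\<tau> a) * ?S"
      using \<tau> by (simp add: mult sum_distrib_left mult_ac)
    finally have "?S * (1 - \<psi> \<tau> * inverse (\<tau> a)) = 0"
      by (simp add: algebra_simps)
    then show ?thesis
      using \<tau> charD(1)[OF \<tau>(1)] by (auto simp: field_simps)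
  qed
  then have "0 = (\<Sum>a\<in>UNIV. \<Sum>\<sigma>\<in>chars. \<psi> \<sigma> * inverse (\<sigma> a))"
    by simp
  also have "\<dots> = (\<Sum>\<sigma>\<in>chars. \<psi> \<sigma> * (\<Sum>a\<in>UNIV. inverse (\<sigma> a)))"
    by (subst sum.swap) (simp add: sum_distrib_left)
  \<comment> \<open>After the interchange of sums, the inner sum over G vanishes for every
    nontrivial character.\<close>
  also have "\<dots> = (\<Sum>\<sigma>\<in>(chars :: ('g \<Rightarrow> complex) set). if \<sigma> = (\<lambda>_. 1) then \<psi> (\<lambda>_. 1) * of_nat CARD('g) else 0)"
  proof (rule sum.cong[OF refl])
    fix \<sigma> :: "'g \<Rightarrow> complex"
    assume \<sigma>: "\<sigma> \<in> chars"
    have "(\<Sum>a\<in>UNIV. inverse (\<sigma> a)) = 0" if "\<sigma> \<noteq> (\<lambda>_. 1)"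
    proof -
      from that obtain b where "\<sigma> b \<noteq> 1"
        by auto
      then show ?thesis
        using char_sum_eq_0[OF char_inverse_closed[OF \<sigma>], of b] by simp
    qed
    then show "\<psi> \<sigma> * (\<Sum>a\<in>UNIV. inverse (\<sigma> a)) =
        (if \<sigma> = (\<lambda>_. 1) then \<psi> (\<lambda>_. 1) * of_nat CARD('g) else 0)"
      by auto
  qed
  also have "\<dots> = \<psi> (\<lambda>_. 1) * of_nat CARD('g)"
    using one by (simp add: finite_chars)
  finally show False
    using nz[OF one] by simp
qed

lemma cnj_char:
  fixes \<sigma> :: "'g::{finite,ab_group_add} \<Rightarrow> complex"
  assumes "\<sigma> \<in> chars"
  shows "cnj (\<sigma> a) = inverse (\<sigma> a)"
proof -
  have "\<sigma> a * cnj (\<sigma> a) = 1"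
    by (simp add: complex_norm_square[symmetric] norm_char[OF assms])
  then show ?thesis
    by (metis inverse_unique)
qed

section \<open>Ideals in the derived series\<close>

lemma lie_algebra_minus_commute:
  assumes "lie_algebra L br" "x \<in> L" "y \<in> L"
  shows "br x y = - br y x"
proof -
  have "x + y \<in> L"
    using assms by (auto simp: lie_algebra_def vec.subspace_add)
  then have "br (x + y) (x + y) = br x x + br x y + (br y x + br y y)"
    using assms unfolding lie_algebra_def by metis
  then have "br x y + br y x = 0"
    using assms \<open>x + y \<in> L\<close> by (simp add: lie_algebra_def)
  then show ?thesis
    by (simp add: eq_neg_iff_add_eq_0)
qed

lemma lie_algebra_derivation:
  assumes "lie_algebra L br" "x \<in> L" "y \<in> L" "z \<in> L"
  shows "br x (br y z) = br (br x y) z + br y (br x z)"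
proof -
  note comm = lie_algebra_minus_commute[OF assms(1)]
  have cl: "br u v \<in> L" if "u \<in> L" "v \<in> L" for u v
    using assms(1) that by (simp add: lie_algebra_def)
  have "br y (- br x z) = - br y (br x z)"
    using assms cl[of x z] vector_sneg_minus1 unfolding lie_algebra_def by metis
  moreover have "br x (br y z) + br y (br z x) + br z (br x y) = 0"
    using assms by (simp add: lie_algebra_def)
  moreover have "br z (br x y) = - br (br x y) z" "br z x = - br x z"
    using assms cl comm by blast+
  ultimately show ?thesis
    by (simp add: algebra_simps)
qed

text \<open>By the derivation rule, [x,[p,q]] = [[x,p],q] + [p,[x,q]], and both terms are again
  brackets of elements of \<open>I\<close>.\<close>

lemma lie_ideal_span_brackets:
  assumes L: "lie_algebra L br" and I: "lie_ideal L br I"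
  shows "lie_ideal L br (vec.span {br x y | x y. x \<in> I \<and> y \<in> I})"
proof -
  define S where "S = {br x y | x y. x \<in> I \<and> y \<in> I}"
  have IL: "x \<in> L" if "x \<in> I" for x
    using I that by (auto simp: lie_ideal_def)
  have "S \<subseteq> L"
    using L IL by (auto simp: S_def lie_algebra_def)
  then have SL: "vec.span S \<subseteq> L"
    using L by (intro vec.span_minimal) (auto simp: lie_algebra_def)
  \<comment> \<open>Membership in \<open>L\<close> is carried through the induction because
    \<open>br\<close> is bilinear only there.\<close>
  have "y \<in> L \<and> br x y \<in> vec.span S" if "x \<in> L" "y \<in> vec.span S" for x y
    using that(2)
  proof (induction rule: vec.span_induct_alt)
    case base
    have "br x (0 *s x) = 0 *s br x x"
      using L that(1) unfolding lie_algebra_def by blast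
    then show ?case
      using L by (simp add: vec.span_zero lie_algebra_def vec.subspace_0)
  next
    case (step c u v)
    from \<open>u \<in> S\<close> obtain p q where u: "u = br p q" and pq: "p \<in> I" "q \<in> I"
      by (auto simp: S_def)
    have "br x p \<in> I" "br x q \<in> I"
      using I that(1) pq by (auto simp: lie_ideal_def)
    then have "br (br x p) q \<in> vec.span S" "br p (br x q) \<in> vec.span S"
      using pq by (auto simp: S_def intro!: vec.span_base)
    then have "br x u \<in> vec.span S"
      using lie_algebra_derivation[OF L that(1) IL IL] pq by (simp add: u vec.span_add)
    moreover have "u \<in> L" "v \<in> L"
      using step \<open>S \<subseteq> L\<close> by auto
    moreover have "c *s u \<in> L" "c *s u + v \<in> L"
      using L calculation by (auto simp: lie_algebra_def vec.subspace_add vec.subspace_scale)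
    moreover have "br x (c *s u + v) = c *s br x u + br x v"
      using L that(1) calculation by (simp add: lie_algebra_def)
    ultimately show ?case
      using step by (simp add: vec.span_add vec.span_scale)
  qed
  then show ?thesis
    using SL by (auto simp: lie_ideal_def S_def[symmetric])
qed

text \<open>Every term of the derived series of an ideal is an ideal, and a term whose successor is
  zero is abelian, hence zero. Descending from the last term reaches the ideal itself.\<close>

lemma semisimple_if_no_abelian_ideals:
  assumes L: "lie_algebra L br"
    and ab: "\<And>A. lie_ideal L br A \<Longrightarrow> (\<And>x y. x \<in> A \<Longrightarrow> y \<in> A \<Longrightarrow> br x y = 0) \<Longrightarrow> A = {0}"
  shows "semisimple_lie_algebra L br"
proof -
  have ideal: "lie_ideal L br (derived_series br I k)" if "lie_ideal L br I" for I k
    by (induction k) (simp_all add: that lie_ideal_span_brackets[OF L])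
  have "I = {0}" if I: "lie_ideal L br I" and "derived_series br I k = {0}" for I k
    using that(2)
  proof (induction k)
    case (Suc k)
    have "br x y = 0" if "x \<in> derived_series br I k" "y \<in> derived_series br I k" for x y
    proof -
      have "br x y \<in> derived_series br I (Suc k)"
        using that by (auto intro!: vec.span_base)
      then show ?thesis
        using Suc.prems by blast
    qed
    then have "derived_series br I k = {0}"
      by (intro ab ideal I)
    then show ?case
      by (rule Suc.IH)
  qed simp
  then show ?thesis
    using L by (auto simp: semisimple_lie_algebra_def lie_solvable_def)
qed

section \<open>The twisted group algebra\<close>

definition twisted_mult ::
  "('g::{finite,ab_group_add} \<Rightarrow> 'g \<Rightarrow> complex) \<Rightarrow> (complex, 'g) vec \<Rightarrow> (complex, 'g) vec \<Rightarrow> (complex, 'g) vec" where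
  "twisted_mult \<xi> x y = (\<chi> d. \<Sum>a\<in>UNIV. x $ a * y $ (d - a) * \<xi> a (d - a))"

lemma twisted_mult_bilinear:
  "twisted_mult \<xi> (x + y) z = twisted_mult \<xi> x z + twisted_mult \<xi> y z"
  "twisted_mult \<xi> x (y + z) = twisted_mult \<xi> x y + twisted_mult \<xi> x z"
  "twisted_mult \<xi> (x - y) z = twisted_mult \<xi> x z - twisted_mult \<xi> y z"
  "twisted_mult \<xi> x (y - z) = twisted_mult \<xi> x y - twisted_mult \<xi> x z"
  "twisted_mult \<xi> (c *s x) z = c *s twisted_mult \<xi> x z"
  "twisted_mult \<xi> x (c *s z) = c *s twisted_mult \<xi> x z"
  by (simp_all add: twisted_mult_def vec_eq_iff algebra_simps sum.distrib sum_subtractf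
      sum_distrib_left)

lemma sum_translate_snd:
  fixes F :: "'g::{finite,ab_group_add} \<Rightarrow> 'g \<Rightarrow> 'a::comm_monoid_add"
  shows "(\<Sum>a\<in>UNIV. \<Sum>e\<in>UNIV. F a e) = (\<Sum>a\<in>UNIV. \<Sum>b\<in>UNIV. F a (a + b))"
proof (rule sum.cong[OF refl])
  fix a
  show "(\<Sum>e\<in>UNIV. F a e) = (\<Sum>b\<in>UNIV. F a (a + b))"
    by (rule sum.reindex_bij_witness[of _ "\<lambda>b. a + b" "\<lambda>e. e - a"]) auto
qed

text \<open>A bimultiplicative \<open>\<xi>\<close> is a 2-cocycle:
  \<open>\<xi> a b * \<xi> (a + b) c\<close> and \<open>\<xi> b c * \<xi> a (b + c)\<close> both
  expand to the product of the three pairwise values.\<close>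

lemma twisted_mult_assoc:
  assumes "bimultiplicative \<xi>"
  shows "twisted_mult \<xi> (twisted_mult \<xi> x y) z = twisted_mult \<xi> x (twisted_mult \<xi> y z)"
proof -
  have \<xi>: "\<xi> (a + b) c = \<xi> a c * \<xi> b c" "\<xi> a (b + c) = \<xi> a b * \<xi> a c" for a b c
    using assms by (auto simp: bimultiplicative_def)
  have "(\<Sum>e\<in>UNIV. (\<Sum>a\<in>UNIV. x $ a * y $ (e - a) * \<xi> a (e - a)) * z $ (d - e) * \<xi> e (d - e)) =
    (\<Sum>a\<in>UNIV. x $ a * (\<Sum>b\<in>UNIV. y $ b * z $ (d - a - b) * \<xi> b (d - a - b)) * \<xi> a (d - a))"
    (is "?l = ?r") for d
  proof -
    have "?l = (\<Sum>a\<in>UNIV. \<Sum>e\<in>UNIV.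
        x $ a * y $ (e - a) * \<xi> a (e - a) * z $ (d - e) * \<xi> e (d - e))"
      by (simp add: sum_distrib_right) (rule sum.swap)
    also have "\<dots> = (\<Sum>a\<in>UNIV. \<Sum>b\<in>UNIV.
        x $ a * y $ b * \<xi> a b * z $ (d - a - b) * \<xi> (a + b) (d - a - b))"
      by (subst sum_translate_snd) (simp add: diff_diff_eq)
    also have "\<dots> = (\<Sum>a\<in>UNIV. \<Sum>b\<in>UNIV.
        x $ a * (y $ b * z $ (d - a - b) * \<xi> b (d - a - b)) * \<xi> a (d - a))"
    proof (intro sum.cong refl)
      fix a b
      have "\<xi> a (d - a) = \<xi> a b * \<xi> a (d - a - b)"
        by (simp flip: \<xi>(2))
      then show "x $ a * y $ b * \<xi> a b * z $ (d - a - b) * \<xi> (a + b) (d - a - b) =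
          x $ a * (y $ b * z $ (d - a - b) * \<xi> b (d - a - b)) * \<xi> a (d - a)"
        by (simp add: \<xi>(1))
    qed
    also have "\<dots> = ?r"
      by (simp add: sum_distrib_left sum_distrib_right)
    finally show ?thesis .
  qed
  then show ?thesis
    by (simp add: twisted_mult_def)
qed

section \<open>The Lie algebra of a finite root system\<close>

lemma mem_root_space: "x \<in> root_space R \<longleftrightarrow> (\<forall>a. a \<notin> R \<longrightarrow> x $ a = 0)"
proof
  assume "x \<in> root_space R"
  then show "\<forall>a. a \<notin> R \<longrightarrow> x $ a = 0"
    unfolding root_space_def
    by (induction rule: vec.span_induct_alt) (auto simp: axis_def split: if_splits)
next
  assume x: "\<forall>a. a \<notin> R \<longrightarrow> x $ a = 0"
  have "(\<Sum>a\<in>UNIV. x $ a *s axis a 1) \<in> root_space R"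
    unfolding root_space_def
  proof (rule vec.span_sum)
    fix a
    show "x $ a *s axis a 1 \<in> vec.span ((\<lambda>a. axis a 1) ` R)"
      using x by (cases "a \<in> R") (auto intro: vec.span_scale vec.span_base vec.span_zero)
  qed
  then show "x \<in> root_space R"
    by (simp add: basis_expansion)
qed

lemma axis_in_root_space: "a \<in> R \<Longrightarrow> axis a 1 \<in> root_space R"
  by (auto simp: mem_root_space axis_def)

lemma subspace_root_space: "vec.subspace (root_space R)"
  by (simp add: root_space_def)

definition herm :: "(complex, 'g::finite) vec \<Rightarrow> (complex, 'g) vec \<Rightarrow> complex" where
  "herm x y = (\<Sum>a\<in>UNIV. x $ a * cnj (y $ a))"

lemma herm_eq_0_iff: "herm x x = 0 \<longleftrightarrow> x = 0"
proof -
  have "herm x x = of_real (\<Sum>a\<in>UNIV. (norm (x $ a))\<^sup>2)"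
    by (simp add: herm_def complex_norm_square del: of_real_power)
  also have "\<dots> = 0 \<longleftrightarrow> x = 0"
    by (simp only: of_real_eq_0_iff) (subst sum_nonneg_eq_0_iff, auto simp: vec_eq_iff)
  finally show ?thesis .
qed

locale root_system_algebra =
  fixes \<beta> \<xi> :: "'g::{finite,ab_group_add} \<Rightarrow> 'g \<Rightarrow> complex" and R :: "'g set"
  assumes root_system: "finite_root_system \<beta> R"
    and bimult: "bimultiplicative \<xi>"
    and commutation_factor: "\<forall>a b. \<xi> a b * inverse (\<xi> b a) = \<beta> a b"
begin

abbreviation "L \<equiv> root_space R"
abbreviation "br \<equiv> root_bracket \<xi> R"

text \<open>Fixing either argument of \<open>\<xi>\<close> gives a character, so the rules for
  inverses and conjugates of characters apply to \<open>\<xi>\<close>.\<close>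

lemma \<xi>_chars: "\<xi> a \<in> chars" "(\<lambda>b. \<xi> b a) \<in> chars"
  using bimult by (auto simp: mem_chars_iff bimultiplicative_def)

lemmas \<xi>_rules =
  charD(1)[OF \<xi>_chars(1)]
  charD(2,4)[OF \<xi>_chars(1)] charD(2,4)[OF \<xi>_chars(2)] cnj_char[OF \<xi>_chars(1)]

lemma \<beta>_eq_1_iff: "\<beta> a b = 1 \<longleftrightarrow> \<xi> a b = \<xi> b a"
  using commutation_factor \<xi>_rules(1)[of b a] by (simp add: field_simps flip: commutation_factor)

lemma minus_root: "a \<in> R \<Longrightarrow> - a \<in> R"
  using root_system by (simp add: finite_root_system_def)

lemma sum_root: "a \<in> R \<Longrightarrow> b \<in> R \<Longrightarrow> \<xi> a b \<noteq> \<xi> b a \<Longrightarrow> a + b \<in> R"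
  using root_system by (simp add: finite_root_system_def \<beta>_eq_1_iff)

text \<open>Induction over sums of roots; inverses of generators are covered because R is closed
  under negation.\<close>

lemma generated_by_roots:
  assumes "P 0" "\<And>a. a \<in> R \<Longrightarrow> P a" "\<And>a b. P a \<Longrightarrow> P b \<Longrightarrow> P (a + b)"
  shows "P a"
proof -
  have inv: "inv\<^bsub>additive_group\<^esub> h = - h" for h :: 'g
    by (rule group.inv_equality[OF group_additive_group]) (auto simp: additive_group_def)
  have "a \<in> generate additive_group R"
    using root_system by (simp add: finite_root_system_def)
  then show ?thesis
  proof induction
    case (inv h)
    then show ?case
      using assms(2)[OF minus_root] by (simp add: \<open>inv\<^bsub>additive_group\<^esub> h = - h\<close>)
  qed (use assms in \<open>auto simp: additive_group_def\<close>)
qed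

text \<open>The elements \<open>b\<close> with \<open>\<xi> a b = \<xi> b a\<close> form a subgroup.
  If it contained all roots it would be G, and \<open>a\<close> would lie in the radical of
  \<open>\<beta>\<close>.\<close>

lemma root_not_central:
  assumes "a \<in> R"
  obtains b where "b \<in> R" "\<xi> a b \<noteq> \<xi> b a"
proof (rule ccontr)
  assume "\<not> thesis"
  then have "\<xi> a b = \<xi> b a" for b
    by (induction b rule: generated_by_roots)
      (use that in \<open>auto simp: \<xi>_rules charD(3)[OF \<xi>_chars(1)] charD(3)[OF \<xi>_chars(2)]\<close>)
  then have "a \<in> Rad \<beta>"
    by (simp add: Rad_def \<beta>_eq_1_iff)
  then show False
    using assms root_system by (auto simp: finite_root_system_def)
qed

lemma zero_not_root: "0 \<notin> R"
  using root_not_central[of 0] charD(3)[OF \<xi>_chars(1)] charD(3)[OF \<xi>_chars(2)] by metis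

text \<open>Coordinates of elements of \<open>L\<close> vanish off R, so the double sum over roots
  extends to G; collecting the terms of degree \<open>d\<close> leaves a convolution.\<close>

lemma bracket_nth:
  assumes "x \<in> L" "y \<in> L"
  shows "br x y $ d = (\<Sum>a\<in>UNIV. x $ a * y $ (d - a) * (\<xi> a (d - a) - \<xi> (d - a) a))"
proof -
  let ?t = "\<lambda>a b. x $ a * y $ b * (\<xi> a b - \<xi> b a) * axis (a + b) 1 $ d"
  have "br x y $ d = (\<Sum>a\<in>R. \<Sum>b\<in>R. ?t a b)"
    by (simp add: root_bracket_def)
  also have "\<dots> = (\<Sum>a\<in>R. \<Sum>b\<in>UNIV. ?t a b)"
    using assms(2) by (intro sum.cong sum.mono_neutral_left) (auto simp: mem_root_space)
  also have "\<dots> = (\<Sum>a\<in>UNIV. \<Sum>b\<in>UNIV. ?t a b)"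
    using assms(1) by (intro sum.mono_neutral_left) (auto simp: mem_root_space)
  also have "\<dots> = (\<Sum>a\<in>UNIV. \<Sum>b\<in>UNIV. if b = d - a then x $ a * y $ b * (\<xi> a b - \<xi> b a) else 0)"
    by (intro sum.cong refl) (auto simp: axis_def)
  finally show ?thesis
    by simp
qed

lemma bracket_eq_commutator:
  assumes "x \<in> L" "y \<in> L"
  shows "br x y = twisted_mult \<xi> x y - twisted_mult \<xi> y x"
proof -
  have "(\<Sum>a\<in>UNIV. x $ a * y $ (d - a) * \<xi> (d - a) a) =
      (\<Sum>a\<in>UNIV. y $ a * x $ (d - a) * \<xi> a (d - a))" for d
    by (rule sum.reindex_bij_witness[of _ "\<lambda>a. d - a" "\<lambda>a. d - a"]) auto
  then show ?thesis
    using assms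
    by (simp add: vec_eq_iff bracket_nth twisted_mult_def right_diff_distrib sum_subtractf)
qed

text \<open>If \<open>d\<close> is not a root but \<open>a\<close> and \<open>d - a\<close> are,
  axiom (FRS2) forces \<open>\<xi>\<close> to be symmetric on this pair, so every contribution to
  the coordinate \<open>d\<close> vanishes.\<close>

lemma bracket_closed:
  assumes "x \<in> L" "y \<in> L"
  shows "br x y \<in> L"
  unfolding mem_root_space
proof (intro allI impI)
  fix d
  assume "d \<notin> R"
  then have "x $ a * y $ (d - a) * (\<xi> a (d - a) - \<xi> (d - a) a) = 0" for a
    using assms sum_root[of a "d - a"] by (force simp: mem_root_space)
  then show "br x y $ d = 0"
    unfolding bracket_nth[OF assms] by (intro sum.neutral ballI)
qed

lemma bracket_jacobi:
  assumes "x \<in> L" "y \<in> L" "z \<in> L"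
  shows "br x (br y z) + br y (br z x) + br z (br x y) = 0"
proof -
  have "br u (br v w) = twisted_mult \<xi> u (twisted_mult \<xi> v w - twisted_mult \<xi> w v) -
      twisted_mult \<xi> (twisted_mult \<xi> v w - twisted_mult \<xi> w v) u"
    if "u \<in> L" "v \<in> L" "w \<in> L" for u v w
    using bracket_eq_commutator[OF that(1) bracket_closed[OF that(2,3)]]
    by (simp add: bracket_eq_commutator[OF that(2,3)])
  then show ?thesis
    using assms by (simp add: twisted_mult_bilinear twisted_mult_assoc[OF bimult])
qed

lemma lie_algebra_root_space: "lie_algebra L br"
  unfolding lie_algebra_def
proof (intro conjI ballI allI)
  fix x y z c
  assume L: "x \<in> L" "y \<in> L"
  then have "x + y \<in> L" "c *s x \<in> L" "c *s y \<in> L"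
    by (auto intro: vec.subspace_add vec.subspace_scale subspace_root_space)
  then show "br (c *s x) y = c *s br x y" "br x (c *s y) = c *s br x y" "br x x = 0"
    using L by (simp_all add: bracket_eq_commutator twisted_mult_bilinear vector_ssub_ldistrib)
  assume "z \<in> L"
  then have "y + z \<in> L"
    using L by (auto intro: vec.subspace_add subspace_root_space)
  then show "br (x + y) z = br x z + br y z" "br x (y + z) = br x y + br x z"
    using L \<open>z \<in> L\<close> \<open>x + y \<in> L\<close> by (simp_all add: bracket_eq_commutator twisted_mult_bilinear)
qed (simp_all add: subspace_root_space bracket_closed bracket_jacobi)

section \<open>Hermitian adjoints and semisimplicity\<close>

definition star :: "(complex, 'g) vec \<Rightarrow> (complex, 'g) vec" where
  "star x = (\<chi> a. cnj (x $ (- a)) * \<xi> a a)"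

lemma star_closed: "x \<in> L \<Longrightarrow> star x \<in> L"
  using minus_root by (force simp: mem_root_space star_def)

lemma bracket_adjoint:
  assumes "x \<in> L" "y \<in> L" "z \<in> L"
  shows "herm (br x y) z = herm y (br (star x) z)"
proof -
  have "herm (br x y) z = (\<Sum>a\<in>UNIV. \<Sum>d\<in>UNIV.
      x $ a * y $ (d - a) * (\<xi> a (d - a) - \<xi> (d - a) a) * cnj (z $ d))"
    using assms by (simp add: herm_def bracket_nth sum_distrib_right) (rule sum.swap)
  also have "\<dots> = (\<Sum>a\<in>UNIV. \<Sum>b\<in>UNIV. x $ a * y $ b * (\<xi> a b - \<xi> b a) * cnj (z $ (a + b)))"
    by (subst sum_translate_snd) simp
  also have "\<dots> = (\<Sum>b\<in>UNIV. \<Sum>a\<in>UNIV. y $ b * cnj (star x $ (- a) * z $ (b + a) *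
      (\<xi> (- a) (b + a) - \<xi> (b + a) (- a))))"
    by (subst sum.swap) (intro sum.cong refl, simp add: star_def \<xi>_rules field_simps)
  also have "\<dots> = (\<Sum>b\<in>UNIV. \<Sum>a\<in>UNIV. y $ b * cnj (star x $ a * z $ (b - a) *
      (\<xi> a (b - a) - \<xi> (b - a) a)))"
    by (intro sum.cong refl sum.reindex_bij_witness[of _ uminus uminus]) auto
  also have "\<dots> = herm y (br (star x) z)"
    using assms by (simp add: herm_def bracket_nth star_closed sum_distrib_left)
  finally show ?thesis .
qed

lemma center_trivial:
  assumes "x \<in> L" "\<And>y. y \<in> L \<Longrightarrow> br x y = 0"
  shows "x = 0"
proof (rule ccontr)
  assume "x \<noteq> 0"
  then obtain a where a: "x $ a \<noteq> 0"
    by (auto simp: vec_eq_iff)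
  then have "a \<in> R"
    using assms(1) by (auto simp: mem_root_space)
  then obtain b where b: "b \<in> R" "\<xi> a b \<noteq> \<xi> b a"
    by (rule root_not_central)
  \<comment> \<open>Only the coordinate of \<open>x\<close> at \<open>a\<close> contributes to
    degree \<open>a + b\<close>, so nothing can cancel this nonzero term.\<close>
  have "br x (axis b 1) $ (a + b) = (\<Sum>c\<in>UNIV. if c = a then x $ a * (\<xi> a b - \<xi> b a) else 0)"
    using bracket_nth[OF assms(1) axis_in_root_space[OF b(1)], of "a + b"]
    by (simp only:) (intro sum.cong refl, auto simp: axis_def algebra_simps)
  then show False
    using a b assms(2)[OF axis_in_root_space[OF b(1)]] by simp
qed

text \<open>
  With \<open>T = ad x\<close> for \<open>x\<close> in an abelian ideal, the adjoint is \<open>T\<^sup>* = ad (star x)\<close> and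
  \<open>T T\<^sup>* T = 0\<close>, which forces \<open>T = 0\<close>.
\<close>

lemma abelian_ideal_trivial:
  assumes A: "lie_ideal L br A" and ab: "\<And>x y. x \<in> A \<Longrightarrow> y \<in> A \<Longrightarrow> br x y = 0"
  shows "A = {0}"
proof -
  have "x = 0" if x: "x \<in> A" for x
  proof (rule center_trivial)
    have AL: "u \<in> L" if "u \<in> A" for u
      using A that by (auto simp: lie_ideal_def)
    show xL: "x \<in> L"
      using AL x .
    fix y
    assume y: "y \<in> L"
    have "vec.subspace A"
      using A by (simp add: lie_ideal_def)
    \<comment> \<open>These are T y and T* T y. The second lies in the abelian ideal, so T kills it
      and its norm is zero; then the norm of T y, being the pairing of \<open>y\<close> with T* T y,
      is zero too.\<close>
    let ?u = "br x y" and ?v = "br (star x) (br x y)"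
    have u: "?u \<in> A"
    proof -
      have "br y x \<in> A"
        using A x y by (auto simp: lie_ideal_def)
      then show ?thesis
        using lie_algebra_minus_commute[OF lie_algebra_root_space xL y]
          vec.subspace_neg[OF \<open>vec.subspace A\<close>] by simp
    qed
    have v: "?v \<in> A"
      using A u star_closed[OF xL] by (auto simp: lie_ideal_def)
    have "herm (br x ?v) ?u = herm ?v ?v"
      using bracket_adjoint[OF xL AL[OF v] AL[OF u]] .
    then have "herm ?v ?v = 0"
      by (simp add: ab x v) (simp add: herm_def)
    then have "?v = 0"
      by (simp add: herm_eq_0_iff)
    have "herm ?u ?u = herm y ?v"
      using bracket_adjoint[OF xL y AL[OF u]] .
    then have "herm ?u ?u = 0"
      by (simp add: \<open>?v = 0\<close>) (simp add: herm_def)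
    then show "?u = 0"
      by (simp add: herm_eq_0_iff)
  qed
  moreover have "0 \<in> A"
    using A by (simp add: lie_ideal_def vec.subspace_0)
  ultimately show ?thesis
    by blast
qed

lemma semisimple: "semisimple_lie_algebra L br"
  by (intro semisimple_if_no_abelian_ideals lie_algebra_root_space abelian_ideal_trivial)

section \<open>The standard grading\<close>

lemma mem_standard_grading: "x \<in> standard_grading R a \<longleftrightarrow> x \<in> L \<and> (\<forall>b. b \<noteq> a \<longrightarrow> x $ b = 0)"
proof (cases "a \<in> R")
  case True
  have "x = x $ a *s axis a 1" if "\<forall>b. b \<noteq> a \<longrightarrow> x $ b = 0"
    using that by (auto simp: vec_eq_iff axis_def)
  then show ?thesis
    using True by (auto simp: standard_grading_def vec.span_singleton mem_root_space axis_def)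
next
  case False
  then show ?thesis
    by (auto simp: standard_grading_def mem_root_space vec_eq_iff)
qed

lemma lie_grading_standard: "lie_grading L br (standard_grading R)"
  unfolding lie_grading_def
proof (intro conjI allI ballI)
  fix a b
  show "vec.subspace (standard_grading R a)"
    by (simp add: standard_grading_def vec.subspace_single_0)
  show "standard_grading R a \<subseteq> L"
    by (auto simp: mem_standard_grading)
  fix x y
  assume xy: "x \<in> standard_grading R a" "y \<in> standard_grading R b"
  then have L: "x \<in> L" "y \<in> L"
    by (auto simp: mem_standard_grading)
  have "br x y $ d = 0" if "d \<noteq> a + b" for d
  proof -
    have *: "x $ c * y $ (d - c) = 0" for c
      using xy that by (cases "c = a") (auto simp: mem_standard_grading diff_eq_eq add.commute)
    then show ?thesis
      by (simp only: bracket_nth[OF L] * mult_zero_left sum.neutral_const)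
  qed
  then show "br x y \<in> standard_grading R (a + b)"
    by (simp add: mem_standard_grading bracket_closed L)
next
  fix x
  assume x: "x \<in> L"
  let ?P = "\<lambda>f. (\<forall>a. f a \<in> standard_grading R a) \<and> finite {a. f a \<noteq> 0} \<and> x = (\<Sum>a | f a \<noteq> 0. f a)"
  have support: "(\<Sum>a | f a \<noteq> 0. f a) = (\<Sum>a\<in>UNIV. f a)" for f :: "'g \<Rightarrow> (complex, 'g) vec"
    by (rule sum.mono_neutral_left) auto
  show "\<exists>!f. ?P f"
  proof (rule ex1I)
    show "?P (\<lambda>a. x $ a *s axis a 1)"
    proof (intro conjI allI)
      show "x $ a *s axis a 1 \<in> standard_grading R a" for a
        using x by (auto simp: mem_standard_grading mem_root_space axis_def)
      show "x = (\<Sum>a | x $ a *s axis a 1 \<noteq> 0. x $ a *s axis a 1)"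
        unfolding support by (simp add: basis_expansion)
    qed simp
    fix f
    assume f: "?P f"
    \<comment> \<open>Each \<open>f c\<close> is supported at the single coordinate
      \<open>c\<close>, so the coordinate \<open>b\<close> of \<open>x\<close> determines
      \<open>f b\<close>; this gives uniqueness.\<close>
    have "f a $ b = (if b = a then x $ b else 0)" for a b
    proof -
      have *: "f c $ b = 0" if "c \<noteq> b" for c
        using f that by (auto simp: mem_standard_grading)
      have "x $ b = (\<Sum>c\<in>UNIV. f c $ b)"
        using f unfolding support by (metis sum_component)
      also have "\<dots> = (\<Sum>c\<in>UNIV. if c = b then f b $ b else 0)"
        using * by (intro sum.cong) auto
      finally show ?thesis
        using * by auto
    qed
    then show "f = (\<lambda>a. x $ a *s axis a 1)"
      by (auto simp: fun_eq_iff vec_eq_iff axis_def)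
  qed
qed

lemma quasi_good: "quasi_good_grading L br (standard_grading R)"
proof -
  have "a \<in> R" if "a \<in> grading_support (standard_grading R)" for a
    using that by (auto simp: grading_support_def standard_grading_def split: if_splits)
  moreover have "vec.dim (standard_grading R a) = 1" if "a \<in> R" for a
    using that by (simp add: standard_grading_def axis_eq_0_iff)
  ultimately show ?thesis
    using lie_grading_standard zero_not_root by (auto simp: quasi_good_grading_def)
qed

end

section \<open>Diagonal automorphisms\<close>

lemma carrier_lie_autI:
  assumes "f \<in> Bij L"
    and "\<And>x y. x \<in> L \<Longrightarrow> y \<in> L \<Longrightarrow> f (x + y) = f x + f y"
    and "\<And>c x. x \<in> L \<Longrightarrow> f (c *s x) = c *s f x"
    and "\<And>x y. x \<in> L \<Longrightarrow> y \<in> L \<Longrightarrow> f (br x y) = br (f x) (f y)"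
  shows "f \<in> carrier (lie_aut L br)"
  using assms by (simp add: lie_aut_def)

lemma carrier_lie_autD:
  assumes "f \<in> carrier (lie_aut L br)"
  shows "f \<in> Bij L"
    and "x \<in> L \<Longrightarrow> f x \<in> L"
    and "x \<in> L \<Longrightarrow> y \<in> L \<Longrightarrow> f (x + y) = f x + f y"
    and "x \<in> L \<Longrightarrow> f (c *s x) = c *s f x"
    and "x \<in> L \<Longrightarrow> y \<in> L \<Longrightarrow> f (br x y) = br (f x) (f y)"
  using assms Bij_imp_funcset[of f L] by (auto simp: lie_aut_def)

lemma mult_lie_aut:
  assumes "f \<in> carrier (lie_aut L br)" "g \<in> carrier (lie_aut L br)"
  shows "f \<otimes>\<^bsub>lie_aut L br\<^esub> g = compose L f g"
  using assms by (simp add: lie_aut_def BijGroup_def)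

lemma group_lie_aut:
  assumes "lie_algebra L br"
  shows "group (lie_aut L br)"
proof -
  define H where "H = carrier (lie_aut L br)"
  have L: "x + y \<in> L" "c *s x \<in> L" "br x y \<in> L" if "x \<in> L" "y \<in> L" for x y c
    using assms that by (auto simp: lie_algebra_def vec.subspace_add vec.subspace_scale)
  interpret group "BijGroup L"
    by (rule group_BijGroup)
  have "subgroup H (BijGroup L)"
  proof (rule subgroupI)
    show "H \<subseteq> carrier (BijGroup L)"
      by (auto simp: H_def BijGroup_def carrier_lie_autD)
    have "(\<lambda>x\<in>L. x) \<in> H"
      unfolding H_def by (rule carrier_lie_autI) (simp_all add: id_Bij L)
    then show "H \<noteq> {}"
      by blast
  next
    fix f
    assume "f \<in> H"
    then have f: "f \<in> carrier (lie_aut L br)"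
      by (simp add: H_def)
    note D = carrier_lie_autD[OF f]
    have "(\<lambda>x\<in>L. inv_into L f x) \<in> H"
      unfolding H_def
    proof (rule carrier_lie_autI)
      show "(\<lambda>x\<in>L. inv_into L f x) \<in> Bij L"
        using D(1) by (rule restrict_inv_into_Bij)
      fix x y c
      assume x: "x \<in> L"
      \<comment> \<open>\<open>Bij_inv_into_lemma\<close> concerns binary operations, so scaling by
        \<open>c\<close> is passed as one that ignores its second argument.\<close>
      have "inv_into L f (c *s x) = c *s inv_into L f x"
        by (rule Bij_inv_into_lemma[of L f "\<lambda>x _. c *s x", OF _ D(1) _ x x]) (auto simp: D(4) L)
      then show "(\<lambda>x\<in>L. inv_into L f x) (c *s x) = c *s (\<lambda>x\<in>L. inv_into L f x) x"
        using x L by simp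
      assume y: "y \<in> L"
      have "inv_into L f (x + y) = inv_into L f x + inv_into L f y"
        by (rule Bij_inv_into_lemma[of L f "(+)", OF _ D(1) _ x y]) (auto simp: D(3) L)
      then show "(\<lambda>x\<in>L. inv_into L f x) (x + y) =
          (\<lambda>x\<in>L. inv_into L f x) x + (\<lambda>x\<in>L. inv_into L f x) y"
        using x y L by simp
      have "inv_into L f (br x y) = br (inv_into L f x) (inv_into L f y)"
        by (rule Bij_inv_into_lemma[of L f br, OF _ D(1) _ x y]) (auto simp: D(5) L)
      then show "(\<lambda>x\<in>L. inv_into L f x) (br x y) =
          br ((\<lambda>x\<in>L. inv_into L f x) x) ((\<lambda>x\<in>L. inv_into L f x) y)"
        using x y L by simp
    qed
    then show "inv\<^bsub>BijGroup L\<^esub> f \<in> H"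
      by (simp add: inv_BijGroup[OF D(1)])
  next
    fix f g
    assume "f \<in> H" "g \<in> H"
    then have f: "f \<in> carrier (lie_aut L br)" and g: "g \<in> carrier (lie_aut L br)"
      by (simp_all add: H_def)
    note F = carrier_lie_autD[OF f] and G = carrier_lie_autD[OF g]
    have "compose L f g \<in> H"
      unfolding H_def
      by (rule carrier_lie_autI) (simp_all add: F G L compose_Bij compose_eq)
    then show "f \<otimes>\<^bsub>BijGroup L\<^esub> g \<in> H"
      using F(1) G(1) by (simp add: BijGroup_def)
  qed
  then have "group ((BijGroup L)\<lparr>carrier := H\<rparr>)"
    by (rule subgroup_imp_group)
  then show ?thesis
    by (simp add: H_def lie_aut_def)
qed

lemma (in group) subgroup_centralizer:
  assumes "S \<subseteq> carrier G"
  shows "subgroup (centralizer G S) G"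
proof (rule subgroupI)
  show "centralizer G S \<subseteq> carrier G"
    by (auto simp: centralizer_def)
  show "centralizer G S \<noteq> {}"
    using assms by (auto simp: centralizer_def intro!: exI[of _ \<one>])
next
  fix g
  assume g: "g \<in> centralizer G S"
  then have gG: "g \<in> carrier G"
    by (simp add: centralizer_def)
  have "inv g \<otimes> s = s \<otimes> inv g" if "s \<in> S" for s
  proof -
    have s: "s \<in> carrier G" "g \<otimes> s = s \<otimes> g"
      using that g assms by (auto simp: centralizer_def)
    have "inv g \<otimes> s = inv g \<otimes> (s \<otimes> g \<otimes> inv g)"
      using s(1) gG by (simp add: m_assoc)
    also have "\<dots> = inv g \<otimes> (g \<otimes> (s \<otimes> inv g))"
      using s(1) gG by (simp only: s(2)[symmetric] m_assoc inv_closed)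
    also have "\<dots> = s \<otimes> inv g"
      using s(1) gG by (simp flip: m_assoc)
    finally show ?thesis .
  qed
  then show "inv g \<in> centralizer G S"
    using gG by (simp add: centralizer_def)
next
  fix g h
  assume "g \<in> centralizer G S" "h \<in> centralizer G S"
  then have gh: "g \<in> carrier G" "h \<in> carrier G"
    and comm: "\<And>s. s \<in> S \<Longrightarrow> g \<otimes> s = s \<otimes> g" "\<And>s. s \<in> S \<Longrightarrow> h \<otimes> s = s \<otimes> h"
    by (auto simp: centralizer_def)
  have "g \<otimes> h \<otimes> s = s \<otimes> (g \<otimes> h)" if "s \<in> S" for s
  proof -
    have s: "s \<in> carrier G"
      using that assms by auto
    have "g \<otimes> h \<otimes> s = g \<otimes> (s \<otimes> h)"
      using gh s by (simp only: m_assoc comm(2)[OF that])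
    also have "\<dots> = s \<otimes> g \<otimes> h"
      using gh s by (simp only: m_assoc[symmetric] comm(1)[OF that])
    also have "\<dots> = s \<otimes> (g \<otimes> h)"
      using gh s by (simp add: m_assoc)
    finally show ?thesis .
  qed
  then show "g \<otimes> h \<in> centralizer G S"
    using gh by (simp add: centralizer_def)
qed

lemma centralizer_commutative_superset:
  assumes "subgroup T A" "D \<subseteq> T" "\<forall>s\<in>T. \<forall>t\<in>T. s \<otimes>\<^bsub>A\<^esub> t = t \<otimes>\<^bsub>A\<^esub> s"
  shows "T \<subseteq> centralizer A D"
  using assms subgroup.subset[OF assms(1)] by (auto simp: centralizer_def)

section \<open>Diagonal maps in the root basis\<close>

lemma dual_action_nth: "x \<in> root_space R \<Longrightarrow> dual_action R \<sigma> x $ a = \<sigma> a * x $ a"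
  by (simp add: dual_action_def)

lemma dual_action_closed: "x \<in> root_space R \<Longrightarrow> dual_action R \<sigma> x \<in> root_space R"
  by (simp add: mem_root_space dual_action_def)

lemma dual_action_add:
  "x \<in> root_space R \<Longrightarrow> y \<in> root_space R \<Longrightarrow>
    dual_action R \<sigma> (x + y) = dual_action R \<sigma> x + dual_action R \<sigma> y"
  by (simp add: vec_eq_iff dual_action_nth vec.subspace_add[OF subspace_root_space] algebra_simps)

lemma dual_action_scale:
  "x \<in> root_space R \<Longrightarrow> dual_action R \<sigma> (c *s x) = c *s dual_action R \<sigma> x"
  by (simp add: vec_eq_iff dual_action_nth vec.subspace_scale[OF subspace_root_space])

lemma dual_action_axis: "a \<in> R \<Longrightarrow> dual_action R \<sigma> (axis a 1) = \<sigma> a *s axis a 1"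
  by (simp add: vec_eq_iff dual_action_nth axis_in_root_space) (simp add: axis_def)

text \<open>Here \<open>\<sigma>\<close> and \<open>\<tau>\<close> are arbitrary functions, so all
  diagonal automorphisms are seen to commute, not only those given by characters.\<close>

lemma compose_dual_action:
  "compose (root_space R) (dual_action R \<sigma>) (dual_action R \<tau>) = dual_action R (\<lambda>a. \<sigma> a * \<tau> a)"
  by (rule extensionalityI[of _ "root_space R"])
    (auto simp: compose_eq dual_action_closed dual_action_nth vec_eq_iff compose_def dual_action_def
      mem_root_space)

lemma semisimple_dual_action: "semisimple_endo (root_space R) (dual_action R \<sigma>)"
proof -
  let ?E = "{v \<in> root_space R. \<exists>c. dual_action R \<sigma> v = c *s v}"
  have "(\<lambda>a. axis a 1) ` R \<subseteq> ?E"
    by (auto simp: axis_in_root_space dual_action_axis)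
  then have "root_space R \<subseteq> vec.span ?E"
    by (subst root_space_def) (rule vec.span_mono)
  moreover have "vec.span ?E \<subseteq> root_space R"
    by (rule vec.span_minimal) (auto simp: subspace_root_space)
  ultimately show ?thesis
    by (simp add: semisimple_endo_def)
qed

text \<open>This serves both the centralizer, where \<open>l\<close> is just a function of matrix
  entries, and a quasitorus inducing the grading, where \<open>l\<close> is a character.\<close>

lemma diagonal_automorphism:
  assumes f: "f \<in> carrier (lie_aut (root_space R) br)"
    and diag: "\<And>a. a \<in> R \<Longrightarrow> f (axis a 1) = l a *s axis a 1"
  shows "f = dual_action R l"
proof (rule extensionalityI[of _ "root_space R"])
  show "f \<in> extensional (root_space R)"
    using carrier_lie_autD(1)[OF f] by (rule Bij_imp_extensional)
  show "dual_action R l \<in> extensional (root_space R)"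
    by (simp add: dual_action_def)
  fix x
  assume "x \<in> root_space R"
  then have "x \<in> vec.span ((\<lambda>a. axis a 1) ` R)"
    by (simp add: root_space_def)
  then have "x \<in> root_space R \<and> f x = dual_action R l x"
  proof (induction rule: vec.span_induct_alt)
    case base
    have 0: "0 \<in> root_space R"
      by (simp add: mem_root_space)
    then show ?case
      using carrier_lie_autD(4)[OF f 0, of 0] by (simp add: dual_action_def vec_eq_iff)
  next
    case (step c u y)
    then obtain a where a: "a \<in> R" "u = axis a 1"
      by auto
    then have u: "u \<in> root_space R"
      by (simp add: axis_in_root_space)
    then have cu: "c *s u \<in> root_space R" and sum: "c *s u + y \<in> root_space R"
      using step by (auto simp: mem_root_space)
    have "f (c *s u + y) = c *s (l a *s u) + dual_action R l y"
      using carrier_lie_autD(3)[OF f cu] carrier_lie_autD(4)[OF f u] step diag a by simp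
    also have "\<dots> = dual_action R l (c *s u + y)"
      using step a u cu by (simp add: dual_action_add dual_action_scale dual_action_axis)
    finally show ?case
      using sum by simp
  qed
  then show "f x = dual_action R l x" ..
qed

context root_system_algebra
begin

section \<open>The dual group and its centralizer\<close>

abbreviation "A \<equiv> lie_aut L br"
abbreviation "D \<equiv> dual_image R"
abbreviation "C \<equiv> centralizer A D"

lemma dual_action_in_aut:
  assumes \<sigma>: "\<sigma> \<in> chars"
  shows "dual_action R \<sigma> \<in> carrier A"
proof (rule carrier_lie_autI)
  have inv: "dual_action R \<tau> (dual_action R \<upsilon> x) = x"
    if "x \<in> L" "\<And>a. \<tau> a * \<upsilon> a = 1" for x \<tau> \<upsilon>
    using that by (simp add: vec_eq_iff dual_action_nth dual_action_closed flip: mult.assoc)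
  have "bij_betw (dual_action R \<sigma>) L L"
    by (rule bij_betwI[where g = "dual_action R (\<lambda>a. inverse (\<sigma> a))"])
      (auto intro!: dual_action_closed inv simp: charD[OF \<sigma>])
  then show "dual_action R \<sigma> \<in> Bij L"
    by (simp add: Bij_def dual_action_def)
  fix x y c
  assume x: "x \<in> L"
  then show "dual_action R \<sigma> (c *s x) = c *s dual_action R \<sigma> x"
    by (rule dual_action_scale)
  assume y: "y \<in> L"
  show "dual_action R \<sigma> (x + y) = dual_action R \<sigma> x + dual_action R \<sigma> y"
    using x y by (rule dual_action_add)
  \<comment> \<open>Each term of the convolution in \<open>bracket_nth\<close> is thereby scaled by
    the same factor \<open>\<sigma> d\<close>.\<close>
  have "\<sigma> d = \<sigma> a * \<sigma> (d - a)" for a d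
    by (simp flip: charD(2)[OF \<sigma>])
  then show "dual_action R \<sigma> (br x y) = br (dual_action R \<sigma> x) (dual_action R \<sigma> y)"
    using x y
    by (auto simp: vec_eq_iff dual_action_nth bracket_closed dual_action_closed bracket_nth
        sum_distrib_left intro!: sum.cong)
qed

lemma dual_image_subset: "D \<subseteq> carrier A"
  by (auto simp: dual_image_def dual_action_in_aut)

lemma diagonal_automorphisms_commute:
  assumes "dual_action R \<sigma> \<in> carrier A" "dual_action R \<tau> \<in> carrier A"
  shows "dual_action R \<sigma> \<otimes>\<^bsub>A\<^esub> dual_action R \<tau> = dual_action R \<tau> \<otimes>\<^bsub>A\<^esub> dual_action R \<sigma>"
  using assms by (simp add: mult_lie_aut compose_dual_action mult.commute)

text \<open>Choose a character separating \<open>a\<close> from \<open>b\<close>. Commutation with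
  it makes the coordinate \<open>b\<close> of the image of \<open>u\<^sub>a\<close> scale by both
  \<open>\<sigma> a\<close> and \<open>\<sigma> b\<close>, so this coordinate is zero.\<close>

lemma centralizer_offdiagonal:
  assumes f: "f \<in> C" and a: "a \<in> R" "b \<noteq> a"
  shows "f (axis a 1) $ b = 0"
proof -
  obtain \<sigma> where \<sigma>: "\<sigma> \<in> chars" "\<sigma> a \<noteq> \<sigma> b"
    using chars_separate[of a b] a(2) by blast
  let ?u = "axis a 1 :: (complex, 'g) vec" and ?s = "dual_action R \<sigma>"
  have fA: "f \<in> carrier A" and comm: "f \<otimes>\<^bsub>A\<^esub> ?s = ?s \<otimes>\<^bsub>A\<^esub> f"
    using f \<sigma> by (auto simp: centralizer_def dual_image_def)
  have u: "?u \<in> L"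
    using a by (simp add: axis_in_root_space)
  have "compose L f ?s = compose L ?s f"
    using comm by (simp add: mult_lie_aut fA dual_action_in_aut \<sigma>)
  then have "f (?s ?u) = ?s (f ?u)"
    using u by (metis compose_eq)
  moreover have "?s ?u = \<sigma> a *s ?u"
    using a by (simp add: dual_action_axis)
  ultimately have "\<sigma> a * f ?u $ b = \<sigma> b * f ?u $ b"
    using carrier_lie_autD(4)[OF fA u, of "\<sigma> a"] carrier_lie_autD(2)[OF fA u]
    by (metis dual_action_nth vector_smult_component)
  then show ?thesis
    using \<sigma>(2) by simp
qed

lemma diagonal_if_offdiagonal_0:
  assumes "f \<in> carrier A" "\<And>a b. a \<in> R \<Longrightarrow> b \<noteq> a \<Longrightarrow> f (axis a 1) $ b = 0"
  shows "f = dual_action R (\<lambda>a. f (axis a 1) $ a)"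
  using assms by (intro diagonal_automorphism) (auto simp: vec_eq_iff axis_def)

text \<open>Off-diagonal matrix entries are polynomial functions on the automorphism group, so this
  form of the centralizer exhibits it as Zariski closed.\<close>

lemma centralizer_eq: "C = {f \<in> carrier A. \<forall>a\<in>R. \<forall>b. b \<noteq> a \<longrightarrow> f (axis a 1) $ b = 0}"
proof (intro equalityI subsetI)
  fix f
  assume "f \<in> C"
  then show "f \<in> {f \<in> carrier A. \<forall>a\<in>R. \<forall>b. b \<noteq> a \<longrightarrow> f (axis a 1) $ b = 0}"
    using centralizer_offdiagonal by (auto simp: centralizer_def)
next
  fix f
  assume "f \<in> {f \<in> carrier A. \<forall>a\<in>R. \<forall>b. b \<noteq> a \<longrightarrow> f (axis a 1) $ b = 0}"
  then have f: "f \<in> carrier A" and "\<exists>l. f = dual_action R l"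
    using diagonal_if_offdiagonal_0[of f] by auto
  then obtain l where l: "f = dual_action R l"
    by blast
  have "f \<otimes>\<^bsub>A\<^esub> s = s \<otimes>\<^bsub>A\<^esub> f" if "s \<in> D" for s
    using that f unfolding l
    by (auto simp: dual_image_def intro!: diagonal_automorphisms_commute dual_action_in_aut)
  then show "f \<in> C"
    using f by (simp add: centralizer_def)
qed

lemma centralizer_diagonal:
  assumes "f \<in> C"
  obtains l where "f = dual_action R l"
  using assms diagonal_if_offdiagonal_0[of f] by (simp add: centralizer_eq)

lemma dual_image_subset_centralizer: "D \<subseteq> C"
proof
  fix f
  assume "f \<in> D"
  then obtain \<sigma> where "\<sigma> \<in> chars" "f = dual_action R \<sigma>"
    by (auto simp: dual_image_def)
  then show "f \<in> C"
    by (simp add: centralizer_eq dual_action_in_aut dual_action_axis) (simp add: axis_def)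
qed

lemma quasitorus_centralizer: "quasitorus L br C"
  unfolding quasitorus_def
proof (intro conjI ballI)
  show "subgroup C A"
    by (intro group.subgroup_centralizer group_lie_aut lie_algebra_root_space dual_image_subset)
  show "zariski_closed_in_aut L br C"
    unfolding zariski_closed_in_aut_def
  proof (intro exI conjI)
    let ?P = "{(\<lambda>f. f (axis a 1) $ b) | a b. a \<in> R \<and> b \<noteq> a}"
    show "?P \<subseteq> poly_functions L"
      by (auto intro: poly_functions.coeff axis_in_root_space)
    show "C = {f \<in> carrier A. \<forall>p\<in>?P. p f = 0}"
      unfolding centralizer_eq by auto
  qed
  fix s t
  assume st: "s \<in> C" "t \<in> C"
  then have A: "s \<in> carrier A" "t \<in> carrier A"
    by (auto simp: centralizer_def)
  obtain l m where lm: "s = dual_action R l" "t = dual_action R m"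
    using st by (elim centralizer_diagonal)
  show "s \<otimes>\<^bsub>A\<^esub> t = t \<otimes>\<^bsub>A\<^esub> s"
    using A unfolding lm by (rule diagonal_automorphisms_commute)
next
  fix t
  assume "t \<in> C"
  then obtain l where "t = dual_action R l"
    by (rule centralizer_diagonal)
  then show "semisimple_endo L t"
    by (simp add: semisimple_dual_action)
qed

lemma maximal_iff_self_centralizing: "maximal_quasitorus L br D \<longleftrightarrow> C = D"
proof
  assume "maximal_quasitorus L br D"
  then show "C = D"
    using quasitorus_centralizer dual_image_subset_centralizer
    by (auto simp: maximal_quasitorus_def)
next
  assume "C = D"
  moreover have "T \<subseteq> C" if "quasitorus L br T" "D \<subseteq> T" for T
    using that by (intro centralizer_commutative_superset) (auto simp: quasitorus_def)
  ultimately show "maximal_quasitorus L br D"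
    using quasitorus_centralizer by (auto simp: maximal_quasitorus_def)
qed

section \<open>Good gradings and maximality\<close>

lemma mem_character_group:
  "\<rho> \<in> carrier (character_group (A\<lparr>carrier := T\<rparr>)) \<longleftrightarrow>
    (\<forall>t\<in>T. \<rho> t \<noteq> 0) \<and> (\<forall>s\<in>T. \<forall>t\<in>T. \<rho> (s \<otimes>\<^bsub>A\<^esub> t) = \<rho> s * \<rho> t) \<and> \<rho> \<in> extensional T"
  by (auto simp: character_group_def hom_def complex_units_def)

text \<open>A quasitorus inducing the grading by \<open>G\<close> acts through characters of \<open>G\<close>, namely \<open>a \<mapsto> \<phi> a t\<close>.\<close>

lemma good_imp_maximal:
  assumes "good_grading L br (standard_grading R)"
  shows "maximal_quasitorus L br D"
proof -
  obtain T \<phi> where T: "maximal_quasitorus L br T"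
    and \<phi>: "\<phi> \<in> iso additive_group (character_group (A\<lparr>carrier := T\<rparr>))"
    and eig: "\<And>a. standard_grading R a = eigencomponent L T (\<phi> a)"
    using assms unfolding good_grading_def by blast
  have TA: "T \<subseteq> carrier A"
    using T by (auto simp: maximal_quasitorus_def quasitorus_def dest: subgroup.subset)
  have mem: "\<phi> a \<in> carrier (character_group (A\<lparr>carrier := T\<rparr>))" for a
    using \<phi> by (auto simp: iso_def hom_def additive_group_def)
  have add: "\<phi> (a + b) = (\<lambda>t\<in>T. \<phi> a t * \<phi> b t)" for a b
    using \<phi> by (auto simp: iso_def hom_def additive_group_def character_group_def)
  have "t \<in> D" if t: "t \<in> T" for t
  proof -
    have "(\<lambda>a. \<phi> a t) \<in> chars"
      using t mem by (auto simp: mem_chars_iff add mem_character_group)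
    moreover have "t = dual_action R (\<lambda>a. \<phi> a t)"
    proof (rule diagonal_automorphism)
      show "t \<in> carrier A"
        using t TA by auto
      fix a
      assume "a \<in> R"
      then have "axis a 1 \<in> standard_grading R a"
        by (simp add: mem_standard_grading axis_in_root_space) (simp add: axis_def)
      then show "t (axis a 1) = \<phi> a t *s axis a 1"
        using t by (simp add: eig eigencomponent_def)
    qed
    ultimately show ?thesis
      by (auto simp: dual_image_def)
  qed
  then have "T = C"
    using T quasitorus_centralizer dual_image_subset_centralizer
    unfolding maximal_quasitorus_def by blast
  then have "D = T"
    using \<open>\<And>t. t \<in> T \<Longrightarrow> t \<in> D\<close> dual_image_subset_centralizer by auto
  then show ?thesis
    using T by simp
qed

text \<open>The action reveals a character only on the roots, but R generates G; hence the dual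
  group embeds.\<close>

lemma dual_action_inj: "inj_on (dual_action R) chars"
proof (rule inj_onI)
  fix \<sigma> \<tau> :: "'g \<Rightarrow> complex"
  assume \<sigma>: "\<sigma> \<in> chars" and \<tau>: "\<tau> \<in> chars" and eq: "dual_action R \<sigma> = dual_action R \<tau>"
  have "\<sigma> a = \<tau> a" for a
  proof (induction a rule: generated_by_roots)
    fix a
    assume "a \<in> R"
    then show "\<sigma> a = \<tau> a"
      using dual_action_nth[OF axis_in_root_space, of a R \<sigma> a]
        dual_action_nth[OF axis_in_root_space, of a R \<tau> a] eq by simp
  qed (simp_all add: charD[OF \<sigma>] charD[OF \<tau>])
  then show "\<sigma> = \<tau>" ..
qed

text \<open>The quasitorus is \<open>D\<close> itself, and \<open>\<phi>\<close> is the biduality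
  map of G transported to \<open>D\<close>: injective because characters separate points, surjective
  by \<open>chars_reflexive\<close>.\<close>

lemma maximal_imp_good:
  assumes "maximal_quasitorus L br D"
  shows "good_grading L br (standard_grading R)"
  unfolding good_grading_def
proof (intro conjI exI bexI)
  \<comment> \<open>\<open>inv_into\<close> recovers the unique character acting as
    \<open>t\<close>, and \<open>\<phi> a\<close> evaluates it at \<open>a\<close>. The restriction
    to \<open>D\<close> makes \<open>\<phi> a\<close> extensional, as elements of
    \<open>character_group\<close> must be.\<close>
  define \<phi> where "\<phi> a = (\<lambda>t\<in>D. inv_into chars (dual_action R) t a)" for a
  let ?X = "character_group (A\<lparr>carrier := D\<rparr>)"
  have \<phi>: "\<phi> a (dual_action R \<sigma>) = \<sigma> a" if "\<sigma> \<in> chars" for a \<sigma>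
    using that by (simp add: \<phi>_def dual_image_def inv_into_f_f[OF dual_action_inj])
  have D_ball: "(\<forall>t\<in>D. P t) \<longleftrightarrow> (\<forall>\<sigma>\<in>chars. P (dual_action R \<sigma>))" for P
    by (simp add: dual_image_def)
  have mult: "dual_action R \<sigma> \<otimes>\<^bsub>A\<^esub> dual_action R \<tau> = dual_action R (\<lambda>a. \<sigma> a * \<tau> a)"
    if "\<sigma> \<in> chars" "\<tau> \<in> chars" for \<sigma> \<tau>
    using that by (simp add: mult_lie_aut dual_action_in_aut compose_dual_action)
  have mem: "\<phi> a \<in> carrier ?X" for a
    unfolding mem_character_group D_ball
    by (auto simp: \<phi> mult char_mult_closed charD) (simp add: \<phi>_def)
  have ext: "\<rho> = \<rho>'" if "\<rho> \<in> carrier ?X" "\<rho>' \<in> carrier ?X"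
    "\<And>\<sigma>. \<sigma> \<in> chars \<Longrightarrow> \<rho> (dual_action R \<sigma>) = \<rho>' (dual_action R \<sigma>)" for \<rho> \<rho>'
    using that(1,2) by (intro extensionalityI[of _ D])
      (auto simp: mem_character_group dual_image_def that(3))
  have "\<phi> (a + b) = (\<lambda>t\<in>D. \<phi> a t * \<phi> b t)" for a b
  proof (rule extensionalityI[of _ D])
    fix t
    assume "t \<in> D"
    then show "\<phi> (a + b) t = (\<lambda>t\<in>D. \<phi> a t * \<phi> b t) t"
      by (auto simp: dual_image_def \<phi> charD)
  qed (simp_all add: \<phi>_def)
  then have hom: "\<phi> \<in> hom additive_group ?X"
    using mem by (auto simp: hom_def additive_group_def character_group_def)
  have "inj \<phi>"
  proof (rule injI)
    fix a b
    assume "\<phi> a = \<phi> b"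
    then show "a = b"
      by (intro chars_separate) (metis \<phi>)
  qed
  moreover have "\<rho> \<in> range \<phi>" if \<rho>: "\<rho> \<in> carrier ?X" for \<rho>
  proof -
    have mult_\<rho>: "\<rho> (dual_action R (\<lambda>a. \<sigma> a * \<tau> a)) = \<rho> (dual_action R \<sigma>) * \<rho> (dual_action R \<tau>)"
      if "\<sigma> \<in> chars" "\<tau> \<in> chars" for \<sigma> \<tau>
      using \<rho> that unfolding mem_character_group D_ball by (simp add: mult)
    have nz_\<rho>: "\<rho> (dual_action R \<sigma>) \<noteq> 0" if "\<sigma> \<in> chars" for \<sigma>
      using \<rho> that unfolding mem_character_group D_ball by simp
    obtain a where "\<And>\<sigma>. \<sigma> \<in> chars \<Longrightarrow> \<rho> (dual_action R \<sigma>) = \<sigma> a"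
      using chars_reflexive[of "\<lambda>\<sigma>. \<rho> (dual_action R \<sigma>)", OF mult_\<rho> nz_\<rho>] by blast
    then have "\<rho> = \<phi> a"
      by (intro ext \<rho> mem) (simp add: \<phi>)
    then show ?thesis
      by blast
  qed
  ultimately have "bij_betw \<phi> UNIV (carrier ?X)"
    using mem by (auto simp: bij_betw_def)
  with hom show "\<phi> \<in> iso additive_group ?X"
    by (simp add: iso_def additive_group_def)
  show "\<forall>a. standard_grading R a = eigencomponent L D (\<phi> a)"
  proof
    fix a
    \<comment> \<open>A vector scaled by \<open>\<sigma> a\<close> under every
      \<open>\<sigma>\<close> has no coordinate at \<open>b\<close> different from \<open>a\<close>,
      since some character separates the two.\<close>
    have "(\<forall>\<sigma>\<in>chars. dual_action R \<sigma> x = \<phi> a (dual_action R \<sigma>) *s x) \<longleftrightarrow> (\<forall>b. b \<noteq> a \<longrightarrow> x $ b = 0)"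
      if x: "x \<in> L" for x
    proof
      assume *: "\<forall>\<sigma>\<in>chars. dual_action R \<sigma> x = \<phi> a (dual_action R \<sigma>) *s x"
      show "\<forall>b. b \<noteq> a \<longrightarrow> x $ b = 0"
      proof (intro allI impI)
        fix b
        assume "b \<noteq> a"
        then obtain \<sigma> where \<sigma>: "\<sigma> \<in> chars" "\<sigma> b \<noteq> \<sigma> a"
          using chars_separate[of b a] by blast
        then have "\<sigma> b * x $ b = \<sigma> a * x $ b"
          using * dual_action_nth[OF x, of \<sigma> b] by (simp add: \<phi>)
        then show "x $ b = 0"
          using \<sigma>(2) by simp
      qed
    next
      assume "\<forall>b. b \<noteq> a \<longrightarrow> x $ b = 0"
      then show "\<forall>\<sigma>\<in>chars. dual_action R \<sigma> x = \<phi> a (dual_action R \<sigma>) *s x"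
        using x by (auto simp: vec_eq_iff dual_action_nth \<phi>)
    qed
    then show "standard_grading R a = eigencomponent L D (\<phi> a)"
      by (simp add: set_eq_iff mem_standard_grading eigencomponent_def D_ball cong: conj_cong)
  qed
  show "finite D"
    by (simp add: dual_image_def finite_chars)
qed (use assms semisimple quasi_good in auto)

end

theorem proposition3p7:
  fixes \<beta> \<xi> :: "'g::{finite,ab_group_add} \<Rightarrow> 'g \<Rightarrow> complex"
    and R :: "'g set"
  assumes "alternating_bicharacter \<beta>"
    and "Rad \<beta> \<noteq> UNIV"
    and "finite_root_system \<beta> R"
    and "bimultiplicative \<xi>"
    and "\<forall>a b. \<xi> a b * inverse (\<xi> b a) = \<beta> a b"
  shows "semisimple_lie_algebra (root_space R) (root_bracket \<xi> R) \<and>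
    quasi_good_grading (root_space R) (root_bracket \<xi> R) (standard_grading R) \<and>
    (good_grading (root_space R) (root_bracket \<xi> R) (standard_grading R) \<longleftrightarrow>
       maximal_quasitorus (root_space R) (root_bracket \<xi> R) (dual_image R)) \<and>
    (maximal_quasitorus (root_space R) (root_bracket \<xi> R) (dual_image R) \<longleftrightarrow>
       centralizer (lie_aut (root_space R) (root_bracket \<xi> R)) (dual_image R) = dual_image R)"
proof -
  interpret root_system_algebra \<beta> \<xi> R
    using assms by unfold_locales
  show ?thesis
    using semisimple quasi_good good_imp_maximal maximal_imp_good maximal_iff_self_centralizing
    by blast
qed

end
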